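(* Let $k,m\ge1$. Then the coded functions $\lceil R|_{\Psi^m_k}\rceil_E$, $\lceil L|_{\Psi^m_k}\rceil_E$ and $\lceil G|_{\Psi^m_k}\rceil_E$ are all in $\mathcal{E}^\Sigma_2$, i.e. they are computable in linear space.
   Context: Constructive ordinals: $\Omega$ is generated by $0$, successor $\alpha+1$, and limits $\langle\alpha_i\rangle_{i\in\mathbb{N}}$; equality is syntactic. $o(0)=0$, $o(n+1)=o(n)+1$, $\omega=\langle o(i+1)\rangle_i$; finite ordinals are the $o(n)$. Arithmetic: $\alpha+0=\alpha$, $\alpha+(\beta+1)=(\alpha+\beta)+1$, $\alpha+\langle\beta_i\rangle=\langle\alpha+\beta_i\rangle$; $\alpha\cdot0=0$, $\alpha\cdot(\beta+1)=\alpha\cdot\beta+\alpha$, $\alpha\cdot\langle\beta_i\rangle=\langle\alpha\cdot\beta_i\rangle$; $\alpha^0=o(1)$, $\alpha^{\beta+1}=\alpha^\beta\cdot\alpha$, $\alpha^{\langle\beta_i\rangle}=\langle\alpha^{\beta_i}\rangle$; write $\omega^p c$ for $\omega^{o(p)}\cdot o(c)$. $\Psi_\omega$ is the closure of $\{0\}\cup\{\omega^{o(p)}:p\in\mathbb{N}\}$ under $+$. For $k,m\ge1$, $\Psi_k^m=\{0\}\cup\{\sum_{i=1}^m\omega^{o(p_i)}c_i+\sum_{j=0}^{k-1}\omega^{o(k-1-j)}d_j : p_i<k\}$ with $c_i,d_j$ finite ordinals. Every nonzero $\alpha\in\Psi_\omega$ has a unique normal form $\alpha=\sum_{i=1}^l\omega^{p_i}c_i$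 with $l\ge1$, $c_i\ge1$, and $p_i\neq p_{i+1}$. Predecessor: $p(0,n)=0$, $p(\alpha+1,n)=\alpha$, $p(\langle\alpha_i\rangle,n)=\alpha_n$. $R^b(0,\alpha,n)=\alpha$, $R^b(i+1,\alpha,n)=p(R^b(i,\alpha,n),n)$. Length hierarchy $L_0(n)=0$, $L_{\alpha+1}(n)=L_\alpha(n)+1$, $L_{\langle\alpha_i\rangle}(n)=L_{\alpha_n}(n)+1$ (as $L(\alpha,n)$); slow-growing hierarchy $G_0(n)=0$, $G_{\alpha+1}(n)=G_\alpha(n)+1$, $G_{\langle\alpha_i\rangle}(n)=G_{\alpha_n}(n)$ (as $G(\alpha,n)$). $R(i,\alpha,n)=R^b(L_\alpha(n)\dot-i,\alpha,n)$. $F|_X$ denotes restriction of ordinal arguments to $X$. Coding over $\Sigma=\{0,1,(,),;,\bot\}$: $\lceil n\rceil_E$ is the binary expansion of $n$; $\lceil0\rceil_E=()$ and, for $\alpha$ with normal form $\sum_{i=1}^l\omega^{p_i}c_i$, $\lceil\alpha\rceil_E=(\lceil p_1\rceil;\lceil c_1\rceil;\cdots;\lceil p_l\rceil;\lceil c_l\rceil)$. For a function $F$ with ordinal arguments in $X\subseteq\Psi_\omega$ and numeral arguments, valued in $\mathbb{N}$ or $X$, $\lceil F\rceil_E$ returns $\lceil F(\bar\alpha,\bar n)\rceil_E$ when each ordinal position holds $\lceil\alpha\rceil_E$ with $\alpha\in X$ and each numeral position holds $\lceil n\rceil_E$, and $\bot$ otherwise. $\mathcal{E}^\Sigma_2$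 is the class of functions $(\Sigma^* )^m\to\Sigma^*$ computable by a multitape Turing machine in space linear in the input lengths. *)

theory Defs
  imports Main
begin

section \<open>Constructive ordinals\<close>

datatype cord = OZero | OSucc cord | OLim "nat \<Rightarrow> cord"

text \<open>Addition is associative and \<open>OZero\<close> is neutral on both sides for the syntactic equality, so the
  ordered sums \<open>\<Sum>\<^sub>i \<alpha>\<^sub>i\<close> are instances of \<^const>\<open>sum_list\<close>. Addition is not commutative.\<close>

instantiation cord :: monoid_add
begin

definition zero_cord :: cord where
  "0 = OZero"

primrec plus_cord :: "cord \<Rightarrow> cord \<Rightarrow> cord" where
  "\<alpha> + OZero = \<alpha>"
| "\<alpha> + OSucc \<beta> = OSucc (\<alpha> + \<beta>)"
| "\<alpha> + OLim b = OLim (\<lambda>i. \<alpha> + b i)"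

instance
proof
  fix \<alpha> \<beta> \<gamma> :: cord
  show "\<alpha> + \<beta> + \<gamma> = \<alpha> + (\<beta> + \<gamma>)"
    by (induction \<gamma>) auto
  show "0 + \<alpha> = \<alpha>"
    by (induction \<alpha>) (auto simp: zero_cord_def)
  show "\<alpha> + 0 = \<alpha>"
    by (simp add: zero_cord_def)
qed

end

instantiation cord :: times
begin

primrec times_cord :: "cord \<Rightarrow> cord \<Rightarrow> cord" where
  "\<alpha> * OZero = OZero"
| "\<alpha> * OSucc \<beta> = \<alpha> * \<beta> + \<alpha>"
| "\<alpha> * OLim b = OLim (\<lambda>i. \<alpha> * b i)"

instance ..

end

primrec ofin :: "nat \<Rightarrow> cord" where
  "ofin 0 = OZero"
| "ofin (Suc n) = OSucc (ofin n)"

primrec opow :: "cord \<Rightarrow> cord \<Rightarrow> cord" where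
  "opow \<alpha> OZero = ofin 1"
| "opow \<alpha> (OSucc \<beta>) = opow \<alpha> \<beta> * \<alpha>"
| "opow \<alpha> (OLim b) = OLim (\<lambda>i. opow \<alpha> (b i))"

definition omega :: cord where
  "omega = OLim (\<lambda>i. ofin (i + 1))"

definition omega_term :: "nat \<Rightarrow> nat \<Rightarrow> cord" where
  "omega_term p c = opow omega (ofin p) * ofin c"

inductive_set Psi_omega :: "cord set" where
  zero: "0 \<in> Psi_omega"
| pow: "opow omega (ofin p) \<in> Psi_omega"
| add: "\<alpha> \<in> Psi_omega \<Longrightarrow> \<beta> \<in> Psi_omega \<Longrightarrow> \<alpha> + \<beta> \<in> Psi_omega"

definition Psi :: "nat \<Rightarrow> nat \<Rightarrow> cord set" where
  "Psi k m = {0} \<union>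
     {(\<Sum>i\<leftarrow>[1..<m+1]. omega_term (p i) (c i)) + (\<Sum>j\<leftarrow>[0..<k]. omega_term (k - 1 - j) (d j))
       | (p :: nat \<Rightarrow> nat) (c :: nat \<Rightarrow> nat) (d :: nat \<Rightarrow> nat). \<forall>i\<in>{1..m}. p i < k}"

section \<open>Normal forms\<close>

definition is_nf :: "cord \<Rightarrow> (nat \<times> nat) list \<Rightarrow> bool" where
  "is_nf \<alpha> pcs \<longleftrightarrow>
     pcs \<noteq> [] \<and> (\<forall>(p, c)\<in>set pcs. c \<ge> 1) \<and> successively (\<lambda>(p, _) (q, _). p \<noteq> q) pcs \<and>
     \<alpha> = (\<Sum>(p, c)\<leftarrow>pcs. omega_term p c)"

definition nf :: "cord \<Rightarrow> (nat \<times> nat) list" where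
  "nf \<alpha> = (THE pcs. is_nf \<alpha> pcs)"

lemma omega_term_0 [simp]: "omega_term p 0 = 0"
  by (simp add: omega_term_def zero_cord_def)

lemma omega_term_Suc: "omega_term p (Suc c) = omega_term p c + opow omega (ofin p)"
  by (simp add: omega_term_def)

lemma omega_term_1: "omega_term p (Suc 0) = opow omega (ofin p)"
  by (simp add: omega_term_Suc)

lemma opow_omega_Suc: "opow omega (ofin (Suc p)) = OLim (\<lambda>i. omega_term p (Suc i))"
  by (simp add: omega_def omega_term_def)

lemma add_opow_omega_inject:
  "\<alpha> + opow omega (ofin p) = \<beta> + opow omega (ofin q) \<Longrightarrow> p = q \<and> \<alpha> = \<beta>"
proof (induction p arbitrary: q)
  case 0
  then show ?case by (cases q) (simp_all add: omega_def)
next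
  case (Suc p)
  show ?case
  proof (cases q)
    case 0
    with Suc.prems show ?thesis by (simp add: omega_def)
  next
    case q: (Suc q')
    from Suc.prems have "\<alpha> + omega_term p (Suc 0) = \<beta> + omega_term q' (Suc 0)"
      unfolding q opow_omega_Suc by (auto dest: fun_cong)
    with Suc.IH[of q'] q show ?thesis by (simp add: omega_term_1)
  qed
qed

lemma add_opow_omega_nonzero: "\<alpha> + opow omega (ofin p) \<noteq> 0"
  by (cases p) (auto simp: zero_cord_def omega_def)

lemma sum_opow_omega_inject:
  "(\<Sum>p\<leftarrow>u. opow omega (ofin p)) = (\<Sum>p\<leftarrow>v. opow omega (ofin p)) \<Longrightarrow> u = v"
proof (induction u arbitrary: v rule: rev_induct)
  case Nil
  then show ?case
    by (cases v rule: rev_cases) (simp_all add: add_opow_omega_nonzero[symmetric])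
next
  case (snoc p u)
  show ?case
  proof (cases v rule: rev_cases)
    case Nil
    with snoc.prems show ?thesis by (simp add: add_opow_omega_nonzero)
  next
    case (snoc v' q)
    with snoc.prems snoc.IH show ?thesis by (auto dest!: add_opow_omega_inject)
  qed
qed

lemma omega_term_conv_sum: "omega_term p c = (\<Sum>q\<leftarrow>replicate c p. opow omega (ofin q))"
proof (induction c)
  case (Suc c)
  then show ?case
    by (simp add: omega_term_Suc flip: replicate_append_same)
qed simp

lemma sum_omega_term_conv:
  "(\<Sum>(p, c)\<leftarrow>pcs. omega_term p c) =
   (\<Sum>q\<leftarrow>concat (map (\<lambda>(p, c). replicate c p) pcs). opow omega (ofin q))"
  by (induction pcs) (auto simp: omega_term_conv_sum simp del: map_replicate)

lemma expand_inject:
  assumes "concat (map (\<lambda>(p, c). replicate c p) xs) = concat (map (\<lambda>(p, c). replicate c p) ys)"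
    and "\<forall>(p, c)\<in>set xs. c \<ge> 1" "successively (\<lambda>(p, _) (q, _). p \<noteq> q) xs"
    and "\<forall>(p, c)\<in>set ys. c \<ge> 1" "successively (\<lambda>(p, _) (q, _). p \<noteq> q) ys"
  shows "xs = (ys :: ('a \<times> nat) list)"
  using assms
proof (induction xs arbitrary: ys)
  case Nil
  then show ?case by (cases ys) auto
next
  case (Cons x xs)
  let ?e = "\<lambda>zs. concat (map (\<lambda>(p, c). replicate c p) zs)"
  have run_le: "c \<le> d"
    if eq: "replicate c p @ ?e zs = replicate d p @ ?e zs'"
      and pos: "\<forall>(p, c)\<in>set zs'. c \<ge> 1"
      and alt: "successively (\<lambda>(p, _) (q, _). p \<noteq> q) ((p, d) # zs')"
    for c d and p :: 'a and zs zs'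
  proof (rule ccontr)
    assume "\<not> c \<le> d"
    then have "c = d + Suc (c - Suc d)" by simp
    then obtain e where c: "c = d + Suc e" by blast
    from eq have "replicate d p @ p # replicate e p @ ?e zs = replicate d p @ ?e zs'"
      unfolding c replicate_add by simp
    then have "p # (replicate e p @ ?e zs) = ?e zs'"
      by (rule same_append_eq[THEN iffD1])
    moreover from this obtain q b zs'' where zs': "zs' = (q, b) # zs''"
      by (cases zs') auto
    moreover from pos obtain b' where "b = Suc b'"
      by (cases b) (auto simp: zs')
    ultimately show False using alt by simp
  qed
  obtain p c where x: "x = (p, c)" by (cases x)
  from Cons.prems have c: "c \<ge> 1" by (simp add: x)
  from Cons.prems c obtain q d ys' where ys: "ys = (q, d) # ys'"
    by (cases ys) (auto simp: x)
  from Cons.prems have d: "d \<ge> 1" by (simp add: ys)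
  from Cons.prems(1) have eq: "replicate c p @ ?e xs = replicate d q @ ?e ys'"
    by (simp add: x ys)
  with c d have [simp]: "q = p" by (cases c; cases d) auto
  have "c \<le> d"
    using Cons.prems by (intro run_le[of c p xs d ys']) (auto simp: x ys)
  moreover have "d \<le> c"
    using Cons.prems by (intro run_le[of d p ys' c xs]) (auto simp: x ys)
  ultimately have [simp]: "d = c" by simp
  from eq have "?e xs = ?e ys'" by simp
  with Cons.prems have "xs = ys'"
    by (intro Cons.IH) (auto simp: x ys successively_Cons)
  then show ?case by (simp add: x ys)
qed

lemma nf_unique:
  assumes "is_nf \<alpha> xs" "is_nf \<alpha> ys"
  shows "xs = ys"
proof (rule expand_inject)
  show "concat (map (\<lambda>(p, c). replicate c p) xs) = concat (map (\<lambda>(p, c). replicate c p) ys)"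
    using assms by (intro sum_opow_omega_inject) (simp add: is_nf_def flip: sum_omega_term_conv)
qed (use assms in \<open>simp_all add: is_nf_def\<close>)

lemma Psi_omega_conv_sum:
  "\<alpha> \<in> Psi_omega \<Longrightarrow> \<exists>ps. \<alpha> = (\<Sum>p\<leftarrow>ps. opow omega (ofin p))"
proof (induction rule: Psi_omega.induct)
  case zero
  show ?case by (rule exI[of _ "[]"]) simp
next
  case (pow p)
  show ?case by (rule exI[of _ "[p]"]) simp
next
  case (add \<alpha> \<beta>)
  then obtain u v where
    "\<alpha> = (\<Sum>p\<leftarrow>u. opow omega (ofin p))" "\<beta> = (\<Sum>p\<leftarrow>v. opow omega (ofin p))" by blast
  then show ?case by (intro exI[of _ "u @ v"]) simp
qed

lemma run_length_exists:
  "\<exists>pcs. (\<forall>(p, c)\<in>set pcs. c \<ge> 1) \<and> successively (\<lambda>(p, _) (q, _). p \<noteq> q) pcs \<and>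
     concat (map (\<lambda>(p, c). replicate c p) pcs) = (ps :: 'a list)"
proof (induction ps)
  case Nil
  show ?case by (rule exI[of _ "[]"]) simp
next
  case (Cons p ps)
  then obtain pcs where pcs: "\<forall>(p, c)\<in>set pcs. (c :: nat) \<ge> 1"
    "successively (\<lambda>(p, _) (q, _). p \<noteq> q) pcs"
    "concat (map (\<lambda>(p, c). replicate c p) pcs) = ps" by blast
  show ?case
  proof (cases "\<exists>c pcs'. pcs = (p, c) # pcs'")
    case True
    then obtain c pcs' where "pcs = (p, c) # pcs'" by blast
    with pcs show ?thesis
      by (intro exI[of _ "(p, Suc c) # pcs'"]) (auto simp: successively_Cons)
  next
    case False
    with pcs show ?thesis
      by (intro exI[of _ "(p, 1) # pcs"]) (cases pcs; auto)
  qed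
qed

lemma nf_exists:
  assumes "\<alpha> \<in> Psi_omega" "\<alpha> \<noteq> 0"
  shows "\<exists>pcs. is_nf \<alpha> pcs"
proof -
  obtain ps where ps: "\<alpha> = (\<Sum>p\<leftarrow>ps. opow omega (ofin p))"
    using Psi_omega_conv_sum[OF assms(1)] ..
  obtain pcs where pcs: "\<forall>(p, c)\<in>set pcs. (c :: nat) \<ge> 1"
    "successively (\<lambda>(p, _) (q, _). p \<noteq> q) pcs"
    "concat (map (\<lambda>(p, c). replicate c p) pcs) = ps" using run_length_exists[of ps] by (elim exE conjE)
  have sum: "\<alpha> = (\<Sum>(p, c)\<leftarrow>pcs. omega_term p c)"
    unfolding sum_omega_term_conv pcs(3) by (rule ps)
  with assms(2) have "pcs \<noteq> []" by (cases pcs) simp_all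
  with pcs(1,2) sum have "is_nf \<alpha> pcs" unfolding is_nf_def by (intro conjI)
  then show ?thesis ..
qed

lemma omega_term_in_Psi_omega: "omega_term p c \<in> Psi_omega"
  by (induction c) (auto simp: omega_term_Suc intro: Psi_omega.intros)

lemma Psi_subset_Psi_omega: "Psi k m \<subseteq> Psi_omega"
proof -
  have "(\<Sum>x\<leftarrow>xs. omega_term (f x) (g x)) \<in> Psi_omega" for xs :: "nat list" and f g
    by (induction xs) (auto intro: Psi_omega.intros omega_term_in_Psi_omega)
  then show ?thesis by (auto simp: Psi_def simp del: upt_Suc intro: Psi_omega.intros)
qed

section \<open>Hierarchies\<close>

primrec opred :: "cord \<Rightarrow> nat \<Rightarrow> cord" where
  "opred OZero n = OZero"
| "opred (OSucc \<alpha>) n = \<alpha>"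
| "opred (OLim a) n = a n"

primrec Rb :: "nat \<Rightarrow> cord \<Rightarrow> nat \<Rightarrow> cord" where
  "Rb 0 \<alpha> n = \<alpha>"
| "Rb (Suc i) \<alpha> n = opred (Rb i \<alpha> n) n"

primrec L_hier :: "cord \<Rightarrow> nat \<Rightarrow> nat" where
  "L_hier OZero n = 0"
| "L_hier (OSucc \<alpha>) n = L_hier \<alpha> n + 1"
| "L_hier (OLim a) n = L_hier (a n) n + 1"

primrec G_hier :: "cord \<Rightarrow> nat \<Rightarrow> nat" where
  "G_hier OZero n = 0"
| "G_hier (OSucc \<alpha>) n = G_hier \<alpha> n + 1"
| "G_hier (OLim a) n = G_hier (a n) n"

definition R_hier :: "nat \<Rightarrow> cord \<Rightarrow> nat \<Rightarrow> cord" where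
  "R_hier i \<alpha> n = Rb (L_hier \<alpha> n - i) \<alpha> n"

section \<open>Coding\<close>

datatype sigma = D0 | D1 | LPar | RPar | Semi | Bot

text \<open>Most significant digit first, no leading zeros; the expansion of \<open>0\<close> is the digit \<open>0\<close>.\<close>

fun code_nat :: "nat \<Rightarrow> sigma list" where
  "code_nat n =
     (if n = 0 then [D0] else if n = 1 then [D1]
      else code_nat (n div 2) @ [if even n then D0 else D1])"

declare code_nat.simps [simp del]

fun join_semi :: "sigma list list \<Rightarrow> sigma list" where
  "join_semi [] = []"
| "join_semi [w] = w"
| "join_semi (w # v # vs) = w @ [Semi] @ join_semi (v # vs)"

definition code_ord :: "cord \<Rightarrow> sigma list" where
  "code_ord \<alpha> =
     (if \<alpha> = 0 then [LPar, RPar]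
      else [LPar] @ join_semi (concat (map (\<lambda>(p, c). [code_nat p, code_nat c]) (nf \<alpha>))) @ [RPar])"

text \<open>The coded version of a function \<open>F\<close> on a set \<open>A\<close> of argument tuples: \<open>enc\<close> turns a tuple into the
  list of the codes of its components, \<open>out\<close> codes the value. Only used with \<open>enc\<close> injective on \<open>A\<close>.\<close>

definition coded ::
  "('x \<Rightarrow> sigma list list) \<Rightarrow> ('y \<Rightarrow> sigma list) \<Rightarrow> 'x set \<Rightarrow> ('x \<Rightarrow> 'y) \<Rightarrow> sigma list list \<Rightarrow> sigma list"
where
  "coded enc out A F ws = (if ws \<in> enc ` A then out (F (inv_into A enc ws)) else [Bot])"

definition coded_R :: "cord set \<Rightarrow> sigma list list \<Rightarrow> sigma list" where
  "coded_R X = coded (\<lambda>(i, \<alpha>, n). [code_nat i, code_ord \<alpha>, code_nat n]) code_ord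
     (UNIV \<times> X \<times> UNIV) (\<lambda>(i, \<alpha>, n). R_hier i \<alpha> n)"

definition coded_L :: "cord set \<Rightarrow> sigma list list \<Rightarrow> sigma list" where
  "coded_L X = coded (\<lambda>(\<alpha>, n). [code_ord \<alpha>, code_nat n]) code_nat
     (X \<times> UNIV) (\<lambda>(\<alpha>, n). L_hier \<alpha> n)"

definition coded_G :: "cord set \<Rightarrow> sigma list list \<Rightarrow> sigma list" where
  "coded_G X = coded (\<lambda>(\<alpha>, n). [code_ord \<alpha>, code_nat n]) code_nat
     (X \<times> UNIV) (\<lambda>(\<alpha>, n). G_hier \<alpha> n)"

section \<open>Multitape Turing machines and linear space\<close>

datatype 'a cell = Blank | Letter 'a | Aux nat

datatype move = MoveL | Stay | MoveR

primrec shift :: "move \<Rightarrow> int" where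
  "shift MoveL = - 1"
| "shift Stay = 0"
| "shift MoveR = 1"

record 'a mtm =
  ntapes :: nat
  states :: "nat set"
  symbols :: "'a cell set"
  start :: nat
  halt :: nat
  trans :: "nat \<Rightarrow> 'a cell list \<Rightarrow> nat \<times> ('a cell \<times> move) list"

definition wf_mtm :: "'a mtm \<Rightarrow> bool" where
  "wf_mtm M \<longleftrightarrow>
     finite (states M) \<and> start M \<in> states M \<and> halt M \<in> states M \<and>
     finite (symbols M) \<and> Blank \<in> symbols M \<and> range Letter \<subseteq> symbols M \<and>
     (\<forall>q\<in>states M. \<forall>cs\<in>lists (symbols M). length cs = ntapes M \<longrightarrow>
        (case trans M q cs of (q', acts) \<Rightarrow>
           q' \<in> states M \<and> length acts = ntapes M \<and> fst ` set acts \<subseteq> symbols M))"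

text \<open>A configuration consists of the state, the contents of the two-way infinite tapes and the head
  positions. Tapes and heads with index \<open>\<ge> ntapes M\<close> are never touched.\<close>

type_synonym 'a config = "nat \<times> (nat \<Rightarrow> int \<Rightarrow> 'a cell) \<times> (nat \<Rightarrow> int)"

definition word_tape :: "'a list \<Rightarrow> int \<Rightarrow> 'a cell" where
  "word_tape w z = (if 0 \<le> z \<and> z < int (length w) then Letter (w ! nat z) else Blank)"

definition init :: "'a mtm \<Rightarrow> 'a list list \<Rightarrow> 'a config" where
  "init M ws = (start M, \<lambda>i. word_tape (if i < length ws then ws ! i else []), \<lambda>i. 0)"

fun step :: "'a mtm \<Rightarrow> 'a config \<Rightarrow> 'a config" where
  "step M (q, T, h) =
     (if q = halt M then (q, T, h)
      else case trans M q (map (\<lambda>i. T i (h i)) [0..<ntapes M]) of (q', acts) \<Rightarrow>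
        (q',
         \<lambda>i. if i < ntapes M then (T i)(h i := fst (acts ! i)) else T i,
         \<lambda>i. if i < ntapes M then h i + shift (snd (acts ! i)) else h i))"

definition run :: "'a mtm \<Rightarrow> 'a list list \<Rightarrow> nat \<Rightarrow> 'a config" where
  "run M ws t = (step M ^^ t) (init M ws)"

text \<open>The number of cells visited on all tapes, input and output tapes included.\<close>

definition space_used :: "'a mtm \<Rightarrow> 'a list list \<Rightarrow> nat \<Rightarrow> nat" where
  "space_used M ws t = card {(i, snd (snd (run M ws s)) i) | i s. i < ntapes M \<and> s \<le> t}"

text \<open>The \<open>m\<close>-ary functions computable in linear space. The inputs are on the tapes \<open>0, \<dots>, m - 1\<close>, the
  output is on tape \<open>m\<close>. The values of \<open>f\<close> on lists of length other than \<open>m\<close> are irrelevant.\<close>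

definition E2 :: "nat \<Rightarrow> ('a list list \<Rightarrow> 'a list) set" where
  "E2 m = {f. \<exists>M c. wf_mtm M \<and> m < ntapes M \<and>
     (\<forall>ws. length ws = m \<longrightarrow>
        (\<exists>t. fst (run M ws t) = halt M \<and>
             fst (snd (run M ws t)) m = word_tape (f ws) \<and>
             space_used M ws t \<le> c * (sum_list (map length ws) + 1)))}"

end

theory Submission
  imports Defs "HOL-Library.Countable"
begin

text \<open>Tapes are read as registers: a word over the alphabet is a number in bijective base 6, so a register
  with a value polynomial in the values of the inputs occupies linear space. Programs that increment,
  decrement and test registers are therefore enough, their running time being irrelevant, and they are
  closed under recursion as long as the values remain polynomially bounded.

  Under \<open>L\<close> and \<open>G\<close> the sums \<open>\<Sum> \<omega>\<^sup>p c\<close> become \<open>\<Sum> c \<cdot> (1 + (n + 1) + \<dots> + (n + 1)\<^sup>p)\<close> and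
  \<open>\<Sum> c \<cdot> (n + 1)\<^sup>p\<close>. Every descent step lowers the length by one, so \<open>R i \<alpha> n\<close> is the ordinal of length
  \<open>min i (L \<alpha> n)\<close> on the descent from \<open>\<alpha>\<close>, which division with remainder by the lengths of \<open>\<omega>\<^sup>p\<close>
  finds. In \<open>\<Psi>\<close> only finitely many lists of exponents occur, hence one treats each of them separately and
  recognises a code by parsing the coefficients and encoding the result again.\<close>

section \<open>Words as numbers\<close>

text \<open>In bijective numeration every word over the six letters is the unique numeral of some
  number, and the empty tape is 0. Inputs are therefore registers as they stand, malformed ones
  included. The price is that every auxiliary function must be total and polynomially bounded on
  arbitrary numbers, so parsing may return garbage that only the final comparison rejects. Fixing
  \<open>k\<close> makes the bounds possible: for \<open>p < k\<close> the powers
  \<open>(n + 1) ^ p\<close> are polynomial in \<open>n\<close>. It also makes the exponents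
  constants of the program, so that only coefficients are computed. The obstacle is the output of
  \<open>R\<close>: along a descent coefficients vanish and equal exponents may become neighbours,
  so the shape of the normal form depends on the input. Distinguishing which coefficients vanish
  makes the shape constant in each case.\<close>

fun digit :: "sigma \<Rightarrow> nat" where
  "digit D0 = 1" | "digit D1 = 2" | "digit LPar = 3" | "digit RPar = 4" | "digit Semi = 5" | "digit Bot = 6"

text \<open>Cyclic successor in the order of \<open>digit\<close>; the wrap-around from
  \<open>Bot\<close> to \<open>D0\<close> is where a carry arises.\<close>

fun up :: "sigma \<Rightarrow> sigma" where
  "up D0 = D1" | "up D1 = LPar" | "up LPar = RPar" | "up RPar = Semi" | "up Semi = Bot" | "up Bot = D0"

fun down :: "sigma \<Rightarrow> sigma" where
  "down D0 = Bot" | "down D1 = D0" | "down LPar = D1" | "down RPar = LPar" | "down Semi = RPar" | "down Bot = Semi"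

text \<open>Bijective base-6 numeration, least significant digit first: the tape contents of a register.\<close>

fun wnum :: "sigma list \<Rightarrow> nat" where
  "wnum [] = 0"
| "wnum (x # w) = digit x + 6 * wnum w"

fun winc :: "sigma list \<Rightarrow> sigma list" where
  "winc [] = [D0]"
| "winc (x # w) = (if x = Bot then D0 # winc w else up x # w)"

lemma wnum_winc: "wnum (winc w) = Suc (wnum w)"
proof (induction w)
  case (Cons x w)
  then show ?case by (cases x) auto
qed simp

lemma digit_bounds: "1 \<le> digit x" "digit x \<le> 6"
  by (cases x; simp)+

lemma digit_inject: "digit x = digit y \<longleftrightarrow> x = y"
  by (cases x; cases y; simp)

lemma wnum_inject: "wnum u = wnum v \<longleftrightarrow> u = v"
proof (induction u arbitrary: v)
  case Nil
  show ?case
  proof (cases v)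
    case (Cons y v')
    then show ?thesis using digit_bounds(1)[of y] by simp
  qed simp
next
  case (Cons x u)
  show ?case
  proof (cases v)
    case Nil
    then show ?thesis using digit_bounds(1)[of x] by auto
  next
    case (Cons y v')
    have "digit x = digit y \<and> wnum u = wnum v'" if "digit x + 6 * wnum u = digit y + 6 * wnum v'"
      using that digit_bounds[of x] digit_bounds[of y] by presburger
    then show ?thesis using Cons.IH[of v'] Cons digit_inject by auto
  qed
qed

lemma wnum_surj: "\<exists>w. wnum w = n"
proof (induction n)
  case 0
  show ?case by (rule exI[of _ "[]"]) simp
next
  case (Suc n)
  then show ?case using wnum_winc by metis
qed

definition nword :: "nat \<Rightarrow> sigma list" where
  "nword n = inv wnum n"

lemma wnum_nword [simp]: "wnum (nword n) = n"
  using wnum_surj unfolding nword_def by (metis f_inv_into_f rangeI)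

lemma nword_wnum [simp]: "nword (wnum w) = w"
  using wnum_inject wnum_nword by blast

lemma nword_0 [simp]: "nword 0 = []"
  using nword_wnum[of "[]"] by simp

lemma nword_eq_Nil [simp]: "nword n = [] \<longleftrightarrow> n = 0"
  by (metis wnum_nword nword_0)

lemma nword_Suc: "nword (Suc n) = winc (nword n)"
  by (metis nword_wnum wnum_nword wnum_winc)

text \<open>All digits are at least 1, so the length of a register is at most logarithmic in its
  value: this turns bounds on values into bounds on space.\<close>

lemma wnum_ge: "2 ^ length w \<le> wnum w + 1"
proof (induction w)
  case (Cons x w)
  then show ?case using digit_bounds(1)[of x] by simp
qed simp

text \<open>The opposite estimate, used for the inputs. Base 8 instead of 6 absorbs the summand 2
  and, being 2 ^ 3, compares directly with the powers of two in \<open>wnum_ge\<close>.\<close>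

lemma wnum_le: "wnum w + 2 \<le> 8 ^ (length w + 1)"
proof (induction w)
  case (Cons x w)
  then show ?case using digit_bounds(2)[of x] by simp
qed simp

section \<open>Counter programs\<close>

text \<open>Countability, shown below, lets lists of commands be encoded as states of a
  machine.\<close>

datatype com = Inc nat | Dec nat | Seq com com | While nat com

instance com :: countable by countable_datatype

text \<open>A derivation certifies termination and that no increment leads beyond \<open>B\<close>.
  \<open>Dec\<close> has no derivation at 0, so an empty tape is never decremented.\<close>

inductive exec :: "nat \<Rightarrow> com \<Rightarrow> (nat \<Rightarrow> nat) \<Rightarrow> (nat \<Rightarrow> nat) \<Rightarrow> bool" for B where
  Inc: "s r < B \<Longrightarrow> exec B (Inc r) s (s(r := s r + 1))"
| Dec: "s r > 0 \<Longrightarrow> exec B (Dec r) s (s(r := s r - 1))"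
| Seq: "exec B a s s' \<Longrightarrow> exec B b s' s'' \<Longrightarrow> exec B (Seq a b) s s''"
| WhileF: "s r = 0 \<Longrightarrow> exec B (While r c) s s"
| WhileT: "s r > 0 \<Longrightarrow> exec B c s s' \<Longrightarrow> exec B (While r c) s' s'' \<Longrightarrow> exec B (While r c) s s''"

lemma exec_bounded: "exec B c s s' \<Longrightarrow> (\<And>r. s r \<le> B) \<Longrightarrow> s' r \<le> B"
proof (induction arbitrary: r rule: exec.induct)
  case (Dec s r')
  then show ?case using le_trans[OF diff_le_self] by auto
qed auto

section \<open>Simulation of counter programs by Turing machines\<close>

text \<open>\<open>Work\<close> carries out the command while a carry or borrow travels right,
  \<open>Return\<close> brings the head back to cell 0, and \<open>Erase\<close> removes the highest
  digit when a borrow has used it up.\<close>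

datatype phase = Work | Return | Erase

instance phase :: countable by countable_datatype

primrec regs :: "com \<Rightarrow> nat set" where
  "regs (Inc r) = {r}"
| "regs (Dec r) = {r}"
| "regs (Seq a b) = regs a \<union> regs b"
| "regs (While r c) = insert r (regs c)"

lemma finite_regs: "finite (regs c)"
  by (induction c) auto

text \<open>The control state is the list of commands still to be executed.
  \<open>stacks c K\<close> collects the lists that occur while \<open>c\<close> runs in front of
  \<open>K\<close>; a loop pushes itself back as a whole, so the set stays finite.\<close>

primrec stacks :: "com \<Rightarrow> com list \<Rightarrow> com list set" where
  "stacks (Inc r) K = {Inc r # K}"
| "stacks (Dec r) K = {Dec r # K}"
| "stacks (Seq a b) K = insert (Seq a b # K) (stacks a (b # K) \<union> stacks b K)"
| "stacks (While r c) K = insert (While r c # K) (stacks c (While r c # K))"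

lemma finite_stacks: "finite (stacks c K)"
  by (induction c arbitrary: K) auto

lemma stacks_self: "c # K \<in> stacks c K"
  by (cases c) auto

text \<open>The one tape on which the current step acts; for \<open>Seq\<close> and the empty list,
  tape 0 is a dummy.\<close>

fun stack_reg :: "com list \<Rightarrow> nat" where
  "stack_reg (Inc r # K) = r"
| "stack_reg (Dec r # K) = r"
| "stack_reg (While r c # K) = r"
| "stack_reg _ = 0"

text \<open>\<open>Return\<close> keeps the finished command on the stack to remember the tape; it
  walks to the blank cell -1 and pops the command on stepping back to cell 0. In \<open>Dec\<close>,
  a blank seen during \<open>Work\<close> means that the borrow has turned the highest digit from
  \<open>D0\<close> into \<open>Bot\<close>, which \<open>Erase\<close> then removes.\<close>

fun act :: "com list \<Rightarrow> phase \<Rightarrow> sigma cell \<Rightarrow> (com list \<times> phase) \<times> sigma cell \<times> move" where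
  "act [] ph x = (([], ph), x, Stay)"
| "act (c # K) Return x =
    (if x = Blank then ((K, Work), Blank, MoveR) else ((c # K, Return), x, MoveL))"
| "act (c # K) Erase x = ((c # K, Return), Blank, MoveL)"
| "act (Inc r # K) Work x =
    (case x of
      Letter y \<Rightarrow>
        ((Inc r # K, if y = Bot then Work else Return), Letter (up y), if y = Bot then MoveR else Stay)
    | _ \<Rightarrow> ((Inc r # K, Return), Letter D0, Stay))"
| "act (Dec r # K) Work x =
    (case x of
      Letter y \<Rightarrow>
        ((Dec r # K, if y = D0 then Work else Return), Letter (down y), if y = D0 then MoveR else Stay)
    | _ \<Rightarrow> ((Dec r # K, Erase), Blank, MoveL))"
| "act (Seq a b # K) Work x = ((a # b # K, Work), x, Stay)"
| "act (While r c # K) Work x =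
    ((if x = Blank then K else c # While r c # K, Work), x, Stay)"

definition machine :: "nat \<Rightarrow> com \<Rightarrow> sigma mtm" where
  "machine n c =
    \<lparr>ntapes = n, states = to_nat ` (insert [] (stacks c []) \<times> (UNIV :: phase set)),
     symbols = insert Blank (range Letter), start = to_nat ([c], Work),
     halt = to_nat ([] :: com list, Work),
     trans = \<lambda>q cs.
       (case from_nat q of (K, ph) \<Rightarrow>
         (case act K ph (cs ! stack_reg K) of (q', y, mv) \<Rightarrow>
           (to_nat q', map (\<lambda>i. if i = stack_reg K then (y, mv) else (cs ! i, Stay)) [0..<n])))\<rparr>"

lemma act_stacks:
  "st \<in> stacks c K \<Longrightarrow> fst (fst (act st ph x)) \<in> insert K (stacks c K)"
proof (induction c arbitrary: K)
  case (Inc r)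
  then show ?case by (cases ph) (auto split: cell.splits)
next
  case (Dec r)
  then show ?case by (cases ph) (auto split: cell.splits)
next
  case (Seq a b)
  from Seq.prems consider "st = Seq a b # K" | "st \<in> stacks a (b # K)" | "st \<in> stacks b K" by auto
  then show ?case
  proof cases
    case 1
    then show ?thesis using stacks_self[of a "b # K"] by (cases ph) auto
  next
    case 2
    then show ?thesis using Seq.IH(1) stacks_self[of b K] by fastforce
  next
    case 3
    then show ?thesis using Seq.IH(2) by fastforce
  qed
next
  case (While r c)
  from While.prems consider "st = While r c # K" | "st \<in> stacks c (While r c # K)" by auto
  then show ?case
  proof cases
    case 1
    then show ?thesis using stacks_self[of c "While r c # K"] by (cases ph) auto
  next
    case 2
    then show ?thesis using While.IH by fastforce
  qed
qed

lemma act_symbol: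
  "x \<in> insert Blank (range Letter) \<Longrightarrow> fst (snd (act st ph x)) \<in> insert Blank (range Letter)"
  by (induction st ph x rule: act.induct) (auto split: cell.splits)

lemma stacks_reg: "st \<in> stacks c K \<Longrightarrow> (\<And>r. r \<in> regs c \<Longrightarrow> r < n) \<Longrightarrow> 0 < n \<Longrightarrow> stack_reg st < n"
  by (induction c arbitrary: K) auto

lemma finite_sigma: "finite (UNIV :: sigma set)"
proof -
  have "(UNIV :: sigma set) \<subseteq> {D0, D1, LPar, RPar, Semi, Bot}"
    using sigma.exhaust by auto
  then show ?thesis by (rule finite_subset) simp
qed

lemma finite_phase: "finite (UNIV :: phase set)"
proof -
  have "(UNIV :: phase set) \<subseteq> {Work, Return, Erase}"
    using phase.exhaust by auto
  then show ?thesis by (rule finite_subset) simp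
qed

lemma wf_machine:
  assumes "\<And>r. r \<in> regs c \<Longrightarrow> r < n" "0 < n"
  shows "wf_mtm (machine n c)"
proof -
  let ?M = "machine n c"
  have "case trans ?M q cs of (q', acts) \<Rightarrow>
      q' \<in> states ?M \<and> length acts = ntapes ?M \<and> fst ` set acts \<subseteq> symbols ?M"
    if q: "q \<in> states ?M" and cs: "cs \<in> lists (symbols ?M)" "length cs = ntapes ?M" for q cs
  proof -
    from q obtain K and ph :: phase where K: "K \<in> insert [] (stacks c [])" "q = to_nat (K, ph)"
      by (auto simp: machine_def)
    obtain K' ph' y mv where a: "act K ph (cs ! stack_reg K) = ((K', ph'), y, mv)"
      using prod_cases3 by (metis prod.exhaust)
    have r: "stack_reg K < n" using K stacks_reg[of K c "[]" n] assms by auto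
    have sym: "cs ! i \<in> insert Blank (range Letter)" if "i < n" for i
      using cs that nth_mem[of i cs] by (auto simp: machine_def)
    have "K' \<in> insert [] (stacks c [])"
      using K(1) act_stacks[of K c "[]" ph "cs ! stack_reg K"] a by (cases K) auto
    moreover have "y \<in> insert Blank (range Letter)"
      using act_symbol[OF sym[OF r], of K ph] a by simp
    ultimately show ?thesis
      using a K(2) by (auto simp: machine_def dest: sym)
  qed
  then show ?thesis
    using finite_stacks finite_phase finite_sigma stacks_self[of c "[]"]
    by (auto simp: wf_mtm_def machine_def)
qed

text \<open>Runs all of whose configurations keep the heads within \<open>{- 1..b}\<close>; -1 is
  the blank cell visited by \<open>Return\<close>. Without a step count, runs compose by plain
  transitivity; \<open>reach_steps\<close> recovers the count.\<close>

inductive reach :: "'a mtm \<Rightarrow> int \<Rightarrow> 'a config \<Rightarrow> 'a config \<Rightarrow> bool" for M b where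
  refl: "(\<And>i. - 1 \<le> h i \<and> h i \<le> b) \<Longrightarrow> reach M b (q, T, h) (q, T, h)"
| step: "(\<And>i. - 1 \<le> h i \<and> h i \<le> b) \<Longrightarrow> reach M b (step M (q, T, h)) z \<Longrightarrow> reach M b (q, T, h) z"

lemma reach_trans: "reach M b x y \<Longrightarrow> reach M b y z \<Longrightarrow> reach M b x z"
  by (induction rule: reach.induct) (auto intro: reach.intros)

lemma reach_steps:
  "reach M b x y \<Longrightarrow>
    \<exists>t. (step M ^^ t) x = y \<and>
      (\<forall>s\<le>t. \<forall>i. - 1 \<le> snd (snd ((step M ^^ s) x)) i \<and> snd (snd ((step M ^^ s) x)) i \<le> b)"
proof (induction rule: reach.induct)
  case (refl h q T)
  then show ?case by (intro exI[of _ 0]) auto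
next
  case (step h q T z)
  then obtain t where t: "(step M ^^ t) (step M (q, T, h)) = z"
    "\<forall>s\<le>t. \<forall>i. - 1 \<le> snd (snd ((step M ^^ s) (step M (q, T, h)))) i \<and>
       snd (snd ((step M ^^ s) (step M (q, T, h)))) i \<le> b" by blast
  show ?case
  proof (intro exI[of _ "Suc t"] conjI allI impI)
    show "(step M ^^ Suc t) (q, T, h) = z" using t(1) by (simp add: funpow_swap1)
  next
    fix s i assume "s \<le> Suc t"
    then show "- 1 \<le> snd (snd ((step M ^^ s) (q, T, h))) i"
      using t(2) step(1) by (cases s) (auto simp del: step.simps simp: funpow_swap1)
  next
    fix s i assume "s \<le> Suc t"
    then show "snd (snd ((step M ^^ s) (q, T, h))) i \<le> b"
      using t(2) step(1) by (cases s) (auto simp del: step.simps simp: funpow_swap1)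
  qed
qed

lemma step_machine:
  assumes "stack_reg K < n" "(K, ph) \<noteq> ([], Work)"
    and "act K ph (T (stack_reg K) (h (stack_reg K))) = (q', y, mv)"
  shows "step (machine n c) (to_nat (K, ph), T, h) =
    (to_nat q', T(stack_reg K := (T (stack_reg K))(h (stack_reg K) := y)),
     h(stack_reg K := h (stack_reg K) + shift mv))"
  using assms by (auto simp: machine_def fun_eq_iff)

text \<open>Prepends a single step, so the runs below are built backwards from their last
  configuration.\<close>

lemma reach_machine_step:
  assumes "reach (machine n c) b (to_nat q', T', h') z"
    and "stack_reg K = r" "r < n" "(K, ph) \<noteq> ([], Work)" "\<And>i. - 1 \<le> h i \<and> h i \<le> b"
    and "act K ph (T r (h r)) = (q', y, mv)"
    and "T' = T(r := (T r)(h r := y))" "h' = h(r := h r + shift mv)"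
  shows "reach (machine n c) b (to_nat (K, ph), T, h) z"
  using assms step_machine[of K n ph T h q' y mv c] by (intro reach.step) simp_all

lemma word_tape_append_nth [simp]: "word_tape (u @ x # w) (int (length u)) = Letter x"
  by (simp add: word_tape_def)

lemma word_tape_end [simp]: "word_tape u (int (length u)) = Blank"
  by (simp add: word_tape_def)

lemma word_tape_update: "(word_tape (u @ x # w))(int (length u) := Letter y) = word_tape (u @ y # w)"
  by (auto simp: word_tape_def fun_eq_iff nth_append nth_Cons')

lemma word_tape_extend: "(word_tape u)(int (length u) := Letter y) = word_tape (u @ [y])"
  by (auto simp: word_tape_def fun_eq_iff nth_append nth_Cons')

lemma word_tape_erase: "(word_tape (u @ [y]))(int (length u) := Blank) = word_tape u"
  by (auto simp: word_tape_def fun_eq_iff nth_append nth_Cons')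

text \<open>Induction on \<open>j\<close>, the distance of the head from cell -1; at
  \<open>j = 0\<close> the head sees the blank.\<close>

lemma reach_return:
  assumes "stack_reg (a # K) = r" "r < n" "\<And>i. - 1 \<le> h i \<and> h i \<le> b" "0 \<le> b"
    and "T r = word_tape w" "h r = int j - 1" "j \<le> length w"
  shows "reach (machine n c) b (to_nat (a # K, Return), T, h) (to_nat (K, Work), T, h(r := 0))"
  using assms
proof (induction j arbitrary: h)
  case 0
  then have x: "T r (h r) = Blank" by (simp add: word_tape_def)
  have "reach (machine n c) b (to_nat (K, Work), T, h(r := 0)) (to_nat (K, Work), T, h(r := 0))"
    using 0 by (intro reach.refl) auto
  then show ?case
    by (rule reach_machine_step[where y = Blank and mv = MoveR and r = r])
      (use 0 x in \<open>auto simp: fun_eq_iff\<close>)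
next
  case (Suc j)
  then have x: "T r (h r) = Letter (w ! j)" by (simp add: word_tape_def)
  have "reach (machine n c) b (to_nat (a # K, Return), T, h(r := int j - 1))
      (to_nat (K, Work), T, (h(r := int j - 1))(r := 0))"
    using Suc.prems Suc.prems(3)[of r] by (intro Suc.IH) auto
  then show ?case unfolding fun_upd_upd
    by (rule reach_machine_step[where y = "Letter (w ! j)" and mv = MoveL and r = r])
      (use Suc.prems x in \<open>auto simp: fun_eq_iff\<close>)
qed

text \<open>\<open>u\<close> is the part that the carry has already passed, \<open>w\<close> the
  part still to be incremented; the induction shifts one letter from \<open>w\<close> to
  \<open>u\<close>.\<close>

lemma reach_Inc:
  assumes "r < n" "\<And>i. - 1 \<le> h i \<and> h i \<le> b"
    and "T r = word_tape (u @ w)" "h r = int (length u)" "int (length (u @ w)) \<le> b"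
  shows "reach (machine n c) b (to_nat (Inc r # K, Work), T, h)
    (to_nat (K, Work), T(r := word_tape (u @ winc w)), h(r := 0))"
  using assms
proof (induction w arbitrary: u T h)
  case Nil
  have "reach (machine n c) b (to_nat (Inc r # K, Return), T(r := word_tape (u @ [D0])), h)
      (to_nat (K, Work), T(r := word_tape (u @ [D0])), h(r := 0))"
    using Nil by (intro reach_return[where w = "u @ [D0]" and j = "Suc (length u)"]) auto
  then show ?case
    unfolding fun_upd_upd winc.simps
    by (rule reach_machine_step[where y = "Letter D0" and mv = Stay and r = r])
      (use Nil in \<open>auto simp: word_tape_extend\<close>)
next
  case (Cons x w)
  show ?case
  proof (cases "x = Bot")
    case True
    then have eq: "u @ winc (x # w) = (u @ [D0]) @ winc w" by simp
    have "reach (machine n c) b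
        (to_nat (Inc r # K, Work), T(r := word_tape ((u @ [D0]) @ w)), h(r := int (length (u @ [D0]))))
        (to_nat (K, Work), (T(r := word_tape ((u @ [D0]) @ w)))(r := word_tape ((u @ [D0]) @ winc w)),
          (h(r := int (length (u @ [D0]))))(r := 0))"
      using Cons.prems by (intro Cons.IH) auto
    then show ?thesis
      unfolding fun_upd_upd eq
      by (rule reach_machine_step[where y = "Letter D0" and mv = MoveR and r = r])
        (use Cons.prems True in \<open>auto simp: word_tape_update\<close>)
  next
    case False
    then have eq: "u @ winc (x # w) = u @ up x # w" by simp
    have "reach (machine n c) b (to_nat (Inc r # K, Return), T(r := word_tape (u @ up x # w)), h)
        (to_nat (K, Work), T(r := word_tape (u @ up x # w)), h(r := 0))"
      using Cons.prems by (intro reach_return[where w = "u @ up x # w" and j = "Suc (length u)"]) auto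
    then show ?thesis
      unfolding eq
      by (rule reach_machine_step[where y = "Letter (up x)" and mv = Stay and r = r])
        (use Cons.prems False in \<open>auto simp: word_tape_update\<close>)
  qed
qed

text \<open>Writing the contents as \<open>winc w\<close> makes decrementing the inverse of
  incrementing: a \<open>Bot\<close> in \<open>w\<close> shows as \<open>D0\<close> on the tape and
  causes a borrow, and an empty \<open>w\<close> shows as the digit to be erased.\<close>

lemma reach_Dec:
  assumes "r < n" "\<And>i. - 1 \<le> h i \<and> h i \<le> b"
    and "T r = word_tape (u @ winc w)" "h r = int (length u)" "int (length (u @ winc w)) \<le> b"
  shows "reach (machine n c) b (to_nat (Dec r # K, Work), T, h)
    (to_nat (K, Work), T(r := word_tape (u @ w)), h(r := 0))"
  using assms
proof (induction w arbitrary: u T h)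
  case Nil
  \<comment> \<open>The tape after the borrow has overwritten the last \<open>D0\<close>; the three
    steps around it are attached in reverse order.\<close>
  let ?T = "T(r := word_tape (u @ [Bot]))"
  have "reach (machine n c) b (to_nat (Dec r # K, Return), T(r := word_tape u), h(r := int (length u) - 1))
      (to_nat (K, Work), T(r := word_tape u), (h(r := int (length u) - 1))(r := 0))"
    using Nil by (intro reach_return[where w = u and j = "length u"]) auto
  then have "reach (machine n c) b (to_nat (Dec r # K, Erase), ?T, h)
      (to_nat (K, Work), T(r := word_tape u), h(r := 0))"
    unfolding fun_upd_upd winc.simps
    by (rule reach_machine_step[where y = Blank and mv = MoveL and r = r])
      (use Nil in \<open>auto simp: word_tape_erase\<close>)
  then have "reach (machine n c) b (to_nat (Dec r # K, Work), ?T, h(r := 1 + int (length u)))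
      (to_nat (K, Work), T(r := word_tape u), h(r := 0))"
    by (rule reach_machine_step[where y = Blank and mv = MoveL and r = r])
      (use Nil in \<open>auto simp: fun_eq_iff word_tape_def\<close>)
  then show ?case
    unfolding append_Nil2
    by (rule reach_machine_step[where y = "Letter Bot" and mv = MoveR and r = r])
      (use Nil in \<open>auto simp: word_tape_update\<close>)
next
  case (Cons x w)
  show ?case
  proof (cases "x = Bot")
    case True
    have "reach (machine n c) b
        (to_nat (Dec r # K, Work), T(r := word_tape ((u @ [Bot]) @ winc w)), h(r := int (length (u @ [Bot]))))
        (to_nat (K, Work), (T(r := word_tape ((u @ [Bot]) @ winc w)))(r := word_tape ((u @ [Bot]) @ w)),
          (h(r := int (length (u @ [Bot]))))(r := 0))"
      using Cons.prems True by (intro Cons.IH) auto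
    then show ?thesis
      unfolding True fun_upd_upd append_assoc append_Cons append_Nil
      by (rule reach_machine_step[where y = "Letter Bot" and mv = MoveR and r = r])
        (use Cons.prems True in \<open>auto simp: word_tape_update\<close>)
  next
    case False
    then have x: "up x \<noteq> D0" "down (up x) = x" by (cases x; simp)+
    have "reach (machine n c) b (to_nat (Dec r # K, Return), T(r := word_tape (u @ x # w)), h)
        (to_nat (K, Work), T(r := word_tape (u @ x # w)), h(r := 0))"
      using Cons.prems by (intro reach_return[where w = "u @ x # w" and j = "Suc (length u)"]) auto
    then show ?thesis
      by (rule reach_machine_step[where y = "Letter x" and mv = Stay and r = r])
        (use Cons.prems False x in \<open>auto simp: word_tape_update\<close>)
  qed
qed

text \<open>Between commands all heads stand at 0 and every tape holds the numeral of its register.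
  Since \<open>exec\<close> keeps all registers below \<open>B\<close>, the length bound
  \<open>b\<close> covers the whole run.\<close>

lemma reach_exec:
  assumes "exec B p s s'" "\<And>r. s r \<le> B" "\<And>r. r \<in> regs p \<Longrightarrow> r < n" "0 < n"
    and "\<And>v. v \<le> B \<Longrightarrow> int (length (nword v)) \<le> b"
  shows "reach (machine n c) b
    (to_nat (p # K, Work), \<lambda>i. word_tape (nword (s i)), \<lambda>_. 0)
    (to_nat (K, Work), \<lambda>i. word_tape (nword (s' i)), \<lambda>_. 0)"
  using assms
proof (induction arbitrary: K rule: exec.induct)
  case (Inc s r)
  have T: "(\<lambda>i. word_tape (nword (s i)))(r := word_tape ([] @ winc (nword (s r)))) =
      (\<lambda>i. word_tape (nword ((s(r := s r + 1)) i)))"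
    by (auto simp: fun_eq_iff nword_Suc)
  have h: "(\<lambda>_. 0)(r := 0) = (\<lambda>_. 0 :: int)" by auto
  show ?case
    using Inc reach_Inc[of r n "\<lambda>_. 0" b "\<lambda>i. word_tape (nword (s i))" "[]" "nword (s r)" c K]
      order_trans[of 0 "int (length (nword (s r)))" b]
    unfolding T h by auto
next
  case (Dec s r)
  have w: "winc (nword (s r - 1)) = nword (s r)"
    using Dec by (metis Suc_diff_1 nword_Suc)
  have T: "(\<lambda>i. word_tape (nword (s i)))(r := word_tape ([] @ nword (s r - 1))) =
      (\<lambda>i. word_tape (nword ((s(r := s r - 1)) i)))"
    by (auto simp: fun_eq_iff)
  have h: "(\<lambda>_. 0)(r := 0) = (\<lambda>_. 0 :: int)" by auto
  show ?case
    using Dec w reach_Dec[of r n "\<lambda>_. 0" b "\<lambda>i. word_tape (nword (s i))" "[]" "nword (s r - 1)" c K]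
      order_trans[of 0 "int (length (nword (s r)))" b]
    unfolding T h by auto
next
  case (Seq a s s' e s'')
  have b: "0 \<le> b" using order_trans[OF _ Seq.prems(4)[of 0]] by simp
  have "reach (machine n c) b
      (to_nat (a # e # K, Work), \<lambda>i. word_tape (nword (s i)), \<lambda>_. 0)
      (to_nat (K, Work), \<lambda>i. word_tape (nword (s'' i)), \<lambda>_. 0)"
    by (rule reach_trans[OF Seq.IH(1) Seq.IH(2)])
      (use Seq.prems exec_bounded[OF Seq.hyps(1)] in auto)
  then show ?case
    by (rule reach_machine_step[where y = "word_tape (nword (s 0)) 0" and mv = Stay and r = 0])
      (use Seq.prems(3) b in \<open>auto simp: fun_eq_iff\<close>)
next
  case (WhileF s r p)
  have b: "0 \<le> b" using order_trans[OF _ WhileF.prems(4)[of 0]] by simp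
  have "reach (machine n c) b
      (to_nat (K, Work), \<lambda>i. word_tape (nword (s i)), \<lambda>_. 0)
      (to_nat (K, Work), \<lambda>i. word_tape (nword (s i)), \<lambda>_. 0)"
    using b by (intro reach.refl) auto
  then show ?case
    by (rule reach_machine_step[where y = Blank and mv = Stay and r = r])
      (use WhileF b in \<open>auto simp: fun_eq_iff word_tape_def\<close>)
next
  case (WhileT s r p s' s'')
  have b: "0 \<le> b" using order_trans[OF _ WhileT.prems(4)[of 0]] by simp
  have "nword (s r) \<noteq> []" using WhileT.hyps by simp
  then have x: "word_tape (nword (s r)) 0 = Letter (nword (s r) ! 0)"
    by (simp add: word_tape_def)
  have "reach (machine n c) b
      (to_nat (p # While r p # K, Work), \<lambda>i. word_tape (nword (s i)), \<lambda>_. 0)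
      (to_nat (K, Work), \<lambda>i. word_tape (nword (s'' i)), \<lambda>_. 0)"
    by (rule reach_trans[OF WhileT.IH(1) WhileT.IH(2)])
      (use WhileT.prems exec_bounded[OF WhileT.hyps(2)] in auto)
  then show ?case
    by (rule reach_machine_step[where y = "word_tape (nword (s r)) 0" and mv = Stay and r = r])
      (use WhileT.prems b x in \<open>auto simp: fun_eq_iff\<close>)
qed

section \<open>Functions computed by counter programs with polynomially bounded registers\<close>

text \<open>The summand 2 makes the size at least 2, so that constants and sums are absorbed by
  raising the exponent.\<close>

definition esize :: "nat \<Rightarrow> (nat \<Rightarrow> nat) \<Rightarrow> nat" where
  "esize N e = 2 + (\<Sum>i<N. e i)"

definition poly_bounded :: "((nat \<Rightarrow> nat) \<Rightarrow> nat) \<Rightarrow> bool" where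
  "poly_bounded f \<longleftrightarrow> (\<exists>N d. \<forall>e. f e \<le> esize N e ^ d)"

definition local_fun :: "nat \<Rightarrow> ((nat \<Rightarrow> nat) \<Rightarrow> nat) \<Rightarrow> bool" where
  "local_fun N f \<longleftrightarrow> (\<forall>e e'. (\<forall>i<N. e i = e' i) \<longrightarrow> f e = f e')"

text \<open>The program for \<open>f\<close> finds variable \<open>i\<close> in register \<open>\<rho> i\<close>, leaves the value in register \<open>M\<close> and
  may use all registers from \<open>M\<close> on, provided that they are zero before and, except for \<open>M\<close>, after the run.\<close>

definition computes :: "nat \<Rightarrow> nat \<Rightarrow> (nat \<Rightarrow> nat) \<Rightarrow> nat \<Rightarrow> com \<Rightarrow> ((nat \<Rightarrow> nat) \<Rightarrow> nat) \<Rightarrow> bool" where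
  "computes N d \<rho> M c f \<longleftrightarrow>
    (\<forall>s B. (\<forall>r\<ge>M. s r = 0) \<longrightarrow> (\<forall>r. s r \<le> B) \<longrightarrow> esize N (\<lambda>i. s (\<rho> i)) ^ d \<le> B \<longrightarrow>
      exec B c s (s(M := f (\<lambda>i. s (\<rho> i)))))"

text \<open>One degree \<open>d\<close> serves all placements \<open>\<rho>\<close> of the
  variables: recursion and renaming move variables to other registers. A placement need not be
  injective, so variables may share a register.\<close>

definition implemented :: "nat \<Rightarrow> nat \<Rightarrow> ((nat \<Rightarrow> nat) \<Rightarrow> nat) \<Rightarrow> bool" where
  "implemented N d f \<longleftrightarrow> local_fun N f \<and> (\<forall>\<rho> M. (\<forall>i<N. \<rho> i < M) \<longrightarrow> (\<exists>c. computes N d \<rho> M c f))"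

definition linspace :: "((nat \<Rightarrow> nat) \<Rightarrow> nat) \<Rightarrow> bool" where
  "linspace f \<longleftrightarrow> (\<exists>N d. implemented N d f)"

section \<open>Polynomial bounds in the size of the environment\<close>

lemma esize_ge_2: "2 \<le> esize N e"
  by (simp add: esize_def)

lemma esize_mono: "N \<le> N' \<Longrightarrow> esize N e \<le> esize N' e"
  by (auto simp: esize_def intro!: sum_mono2)

lemma esize_power_mono: "N \<le> N' \<Longrightarrow> d \<le> d' \<Longrightarrow> esize N e ^ d \<le> esize N' e ^ d'"
  using esize_ge_2[of N' e] esize_mono[of N N' e]
  by (intro order_trans[OF power_mono power_increasing]) auto

lemma esize_cong: "(\<And>i. i < N \<Longrightarrow> e i = e' i) \<Longrightarrow> esize N e = esize N e'"
  by (simp add: esize_def)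

lemma var_le_esize: "i < N \<Longrightarrow> e i \<le> esize N e"
  using member_le_sum[of i "{..<N}" e] by (simp add: esize_def)

lemma poly_bounded_le: "poly_bounded g \<Longrightarrow> (\<And>e. f e \<le> g e) \<Longrightarrow> poly_bounded f"
  unfolding poly_bounded_def by (meson order_trans)

lemma poly_bounded_obtain_common:
  assumes "poly_bounded f" "poly_bounded g"
  obtains N d where "\<And>e. f e \<le> esize N e ^ d" "\<And>e. g e \<le> esize N e ^ d"
proof -
  from assms obtain N d N' d' where
    "\<And>e. f e \<le> esize N e ^ d" "\<And>e. g e \<le> esize N' e ^ d'" unfolding poly_bounded_def by blast
  then show thesis
    using esize_power_mono[of N "max N N'" d "max d d'"] esize_power_mono[of N' "max N N'" d' "max d d'"]
    by (intro that[of "max N N'" "max d d'"]) (meson max.cobounded1 max.cobounded2 order_trans)+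
qed

lemma poly_bounded_var: "poly_bounded (\<lambda>e. e i)"
  unfolding poly_bounded_def using var_le_esize[of i "Suc i"]
  by (intro exI[of _ "Suc i"] exI[of _ 1]) simp

lemma poly_bounded_const: "poly_bounded (\<lambda>e. c)"
proof -
  have "c \<le> esize 0 e ^ c" for e
    using power_mono[OF esize_ge_2[of 0 e], of c] less_exp[of c] by linarith
  then show ?thesis unfolding poly_bounded_def by blast
qed

lemma poly_bounded_mult:
  assumes "poly_bounded f" "poly_bounded g"
  shows "poly_bounded (\<lambda>e. f e * g e)"
proof -
  obtain N d where "\<And>e. f e \<le> esize N e ^ d" "\<And>e. g e \<le> esize N e ^ d"
    using poly_bounded_obtain_common[OF assms] by metis
  then have "f e * g e \<le> esize N e ^ (d + d)" for e
    by (auto simp: power_add intro: mult_mono)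
  then show ?thesis unfolding poly_bounded_def by blast
qed

lemma poly_bounded_add:
  assumes "poly_bounded f" "poly_bounded g"
  shows "poly_bounded (\<lambda>e. f e + g e)"
proof -
  obtain N d where b: "\<And>e. f e \<le> esize N e ^ d" "\<And>e. g e \<le> esize N e ^ d"
    using poly_bounded_obtain_common[OF assms] by metis
  have "f e + g e \<le> esize N e ^ Suc d" for e
    using b[of e] mult_le_mono1[OF esize_ge_2[of N e], of "esize N e ^ d"] unfolding power_Suc by linarith
  then show ?thesis unfolding poly_bounded_def by blast
qed

lemmas poly_bounded_intros = poly_bounded_var poly_bounded_const poly_bounded_mult poly_bounded_add

lemma computesD:
  "computes N d \<rho> M c f \<Longrightarrow> \<forall>r\<ge>M. s r = 0 \<Longrightarrow> \<forall>r. s r \<le> B \<Longrightarrow> esize N (\<lambda>i. s (\<rho> i)) ^ d \<le> B \<Longrightarrow>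
    exec B c s (s(M := f (\<lambda>i. s (\<rho> i))))"
  by (simp add: computes_def)

lemma computesI:
  "(\<And>s B. \<forall>r\<ge>M. s r = 0 \<Longrightarrow> \<forall>r. s r \<le> B \<Longrightarrow> esize N (\<lambda>i. s (\<rho> i)) ^ d \<le> B \<Longrightarrow>
    exec B c s (s(M := f (\<lambda>i. s (\<rho> i))))) \<Longrightarrow> computes N d \<rho> M c f"
  by (simp add: computes_def)

lemma implementedE:
  assumes "implemented N d f" "\<forall>i<N. \<rho> i < M"
  obtains c where "computes N d \<rho> M c f"
  using assms unfolding implemented_def by blast

lemma implemented_local: "implemented N d f \<Longrightarrow> local_fun N f"
  by (simp add: implemented_def)

lemma local_funD: "local_fun N f \<Longrightarrow> (\<And>i. i < N \<Longrightarrow> e i = e' i) \<Longrightarrow> f e = f e'"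
  unfolding local_fun_def by blast

lemma implemented_mono:
  assumes "implemented N d f" "N \<le> N'" "d \<le> d'"
  shows "implemented N' d' f"
  unfolding implemented_def
proof (intro conjI allI impI)
  show "local_fun N' f"
    using assms(2) implemented_local[OF assms(1)] unfolding local_fun_def by auto
next
  fix \<rho> :: "nat \<Rightarrow> nat" and M assume "\<forall>i<N'. \<rho> i < M"
  then have "\<forall>i<N. \<rho> i < M" using assms(2) by auto
  then obtain c where c: "computes N d \<rho> M c f" by (rule implementedE[OF assms(1)])
  show "\<exists>c. computes N' d' \<rho> M c f"
    by (intro exI[of _ c] computesI computesD[OF c] order_trans[OF esize_power_mono[OF assms(2,3)]]) auto
qed

text \<open>The result is left in a register at the end of a run bounded by \<open>B\<close>, so it
  is at most \<open>B\<close>.\<close>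

lemma implemented_poly_bounded:
  assumes "implemented N d f"
  shows "f e \<le> esize N e ^ Suc d"
proof -
  define s where "s = (\<lambda>i. if i < N then e i else 0)"
  \<comment> \<open>\<open>Suc d\<close> instead of \<open>d\<close>: the initial registers must fit
    below \<open>B\<close> even when \<open>d = 0\<close>.\<close>
  define B where "B = esize N e ^ Suc d"
  have e: "esize N s = esize N e" by (auto simp: s_def intro: esize_cong)
  obtain c where c: "computes N d (\<lambda>i. i) N c f"
    by (rule implementedE[OF assms, of "\<lambda>i. i" N]) auto
  have le: "\<forall>r. s r \<le> B"
    using var_le_esize[of _ N e] esize_power_mono[of N N 1 "Suc d" e]
    by (auto simp: s_def B_def simp del: power_Suc intro: order_trans)
  have "exec B c s (s(N := f s))"
    using le esize_power_mono[of N N d "Suc d" e]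
    by (intro computesD[OF c, simplified]) (auto simp: s_def[abs_def] B_def e[unfolded s_def])
  from exec_bounded[OF this, of N] le have "f s \<le> B" by simp
  moreover have "f s = f e"
    by (rule local_funD[OF implemented_local[OF assms]]) (simp add: s_def)
  ultimately show ?thesis by (simp add: B_def)
qed

lemma linspace_poly_bounded: "linspace f \<Longrightarrow> poly_bounded f"
  unfolding linspace_def poly_bounded_def using implemented_poly_bounded by blast

section \<open>Basic programs and closure properties of \<open>linspace\<close>\<close>

lemma exec_clear: "exec B (While r (Dec r)) s (s(r := 0))"
proof (induction "s r" arbitrary: s)
  case 0
  then show ?case using exec.WhileF[of s r] by (simp add: fun_upd_idem)
next
  case (Suc n)
  have "exec B (While r (Dec r)) (s(r := s r - 1)) ((s(r := s r - 1))(r := 0))"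
    using Suc(2) by (intro Suc(1)) simp
  moreover have "0 < s r" using Suc(2) by simp
  ultimately show ?case using exec.WhileT[OF _ exec.Dec[of s r]] by simp
qed

lemma exec_move:
  "a \<noteq> b \<Longrightarrow> s a + s b \<le> B \<Longrightarrow>
    exec B (While a (Seq (Dec a) (Inc b))) s (s(a := 0, b := s a + s b))"
proof (induction "s a" arbitrary: s)
  case 0
  then show ?case using exec.WhileF[of s a] by (simp add: fun_upd_idem)
next
  case (Suc n)
  let ?s = "(s(a := s a - 1))(b := (s(a := s a - 1)) b + 1)"
  have "exec B (While a (Seq (Dec a) (Inc b))) ?s (?s(a := 0, b := ?s a + ?s b))"
    using Suc by (intro Suc(1)) auto
  also have "?s(a := 0, b := ?s a + ?s b) = s(a := 0, b := s a + s b)"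
    using Suc by auto
  finally have w: "exec B (While a (Seq (Dec a) (Inc b))) ?s (s(a := 0, b := s a + s b))" .
  show ?case by (rule exec.WhileT[OF _ exec.Seq[OF exec.Dec exec.Inc] w]) (use Suc in auto)
qed

text \<open>Copying destroys its source; one of the two copies later serves to restore it.\<close>

lemma exec_copy:
  assumes "a \<noteq> b" "a \<noteq> t" "b \<noteq> t" "s b + s a \<le> B" "s t + s a \<le> B"
  shows "exec B (While a (Seq (Dec a) (Seq (Inc b) (Inc t)))) s (s(a := 0, b := s a + s b, t := s a + s t))"
  using assms
proof (induction "s a" arbitrary: s)
  case 0
  then show ?case using exec.WhileF[of s a] by (simp add: fun_upd_idem)
next
  case (Suc n)
  let ?s = "s(a := s a - 1, b := s b + 1, t := s t + 1)"
  have 1: "exec B (Seq (Dec a) (Seq (Inc b) (Inc t))) s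
      ((((s(a := s a - 1))(b := (s(a := s a - 1)) b + 1)))
        (t := ((s(a := s a - 1))(b := (s(a := s a - 1)) b + 1)) t + 1))"
    using Suc by (intro exec.Seq[OF exec.Dec exec.Seq[OF exec.Inc exec.Inc]]) auto
  have "exec B (While a (Seq (Dec a) (Seq (Inc b) (Inc t)))) ?s
      (?s(a := 0, b := ?s a + ?s b, t := ?s a + ?s t))"
    using Suc by (intro Suc(1)) auto
  also have "?s(a := 0, b := ?s a + ?s b, t := ?s a + ?s t) = s(a := 0, b := s a + s b, t := s a + s t)"
    using Suc by auto
  finally have w: "exec B (While a (Seq (Dec a) (Seq (Inc b) (Inc t)))) ?s
      (s(a := 0, b := s a + s b, t := s a + s t))" .
  show ?case by (rule exec.WhileT[OF _ _ w]) (use Suc 1 in auto)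
qed

lemma linspace_0: "linspace (\<lambda>e. 0)"
proof -
  have "\<exists>c. computes 0 0 \<rho> M c (\<lambda>e. 0)" for \<rho> M
  \<comment> \<open>As \<open>M\<close> holds 0, the loop body is never entered: this is the skip
    command.\<close>
  proof (intro exI[of _ "While M (Inc M)"] computesI)
    fix B and s :: "nat \<Rightarrow> nat"
    assume "\<forall>r\<ge>M. s r = 0"
    then show "exec B (While M (Inc M)) s (s(M := 0))"
      using exec.WhileF[of s M] by (simp add: fun_upd_idem)
  qed
  then have "implemented 0 0 (\<lambda>e. 0)"
    unfolding implemented_def local_fun_def by blast
  then show ?thesis unfolding linspace_def by blast
qed

lemma linspace_var: "linspace (\<lambda>e. e j)"
proof -
  have "\<exists>c. computes (Suc j) 0 \<rho> M c (\<lambda>e. e j)"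
    if \<rho>: "\<forall>i<Suc j. \<rho> i < M" for M and \<rho> :: "nat \<Rightarrow> nat"
  proof (rule exI[of _ "Seq (While (\<rho> j) (Seq (Dec (\<rho> j)) (Seq (Inc M) (Inc (Suc M)))))
       (While (Suc M) (Seq (Dec (Suc M)) (Inc (\<rho> j))))"], intro computesI exec.Seq)
    fix B and s :: "nat \<Rightarrow> nat"
    assume s: "\<forall>r\<ge>M. s r = 0" "\<forall>r. s r \<le> B"
    have j: "\<rho> j < M" using \<rho> by simp
    let ?s = "s(\<rho> j := 0, M := s (\<rho> j) + s M, Suc M := s (\<rho> j) + s (Suc M))"
    show "exec B (While (\<rho> j) (Seq (Dec (\<rho> j)) (Seq (Inc M) (Inc (Suc M))))) s ?s"
      using s j by (intro exec_copy) auto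
    have "exec B (While (Suc M) (Seq (Dec (Suc M)) (Inc (\<rho> j)))) ?s
        (?s(Suc M := 0, \<rho> j := ?s (Suc M) + ?s (\<rho> j)))"
      using s j by (intro exec_move) auto
    also have "?s(Suc M := 0, \<rho> j := ?s (Suc M) + ?s (\<rho> j)) = s(M := s (\<rho> j))"
      using s j by auto
    finally show "exec B (While (Suc M) (Seq (Dec (Suc M)) (Inc (\<rho> j)))) ?s (s(M := s (\<rho> j)))" .
  qed
  then have "implemented (Suc j) 0 (\<lambda>e. e j)"
    unfolding implemented_def local_fun_def by blast
  then show ?thesis unfolding linspace_def by blast
qed

lemma linspace_Suc:
  assumes "linspace f"
  shows "linspace (\<lambda>e. Suc (f e))"
proof -
  obtain N d where f: "implemented N d f" using assms unfolding linspace_def by blast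
  \<comment> \<open>The values are bounded with exponent \<open>Suc d\<close>; one more degree
    leaves room for the final increment.\<close>
  have "\<exists>c. computes N (Suc (Suc d)) \<rho> M c (\<lambda>e. Suc (f e))"
    if \<rho>: "\<forall>i<N. \<rho> i < M" for M and \<rho> :: "nat \<Rightarrow> nat"
  proof -
    obtain c where c: "computes N d \<rho> M c f" by (rule implementedE[OF f \<rho>])
    show ?thesis
    proof (rule exI[of _ "Seq c (Inc M)"], intro computesI exec.Seq)
      fix B and s :: "nat \<Rightarrow> nat"
      assume s: "\<forall>r\<ge>M. s r = 0" "\<forall>r. s r \<le> B" "esize N (\<lambda>i. s (\<rho> i)) ^ Suc (Suc d) \<le> B"
      let ?e = "\<lambda>i. s (\<rho> i)"
      have "esize N ?e ^ d \<le> B"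
        using s(3) esize_power_mono[of N N d "Suc (Suc d)" ?e] by linarith
      with c s(1,2) show "exec B c s (s(M := f ?e))" by (rule computesD)
      have "f ?e < esize N ?e ^ Suc (Suc d)"
        using implemented_poly_bounded[OF f, of ?e] esize_ge_2[of N ?e]
          power_strict_increasing[of "Suc d" "Suc (Suc d)" "esize N ?e"] by linarith
      then have "f ?e < B" using s(3) by linarith
      then show "exec B (Inc M) (s(M := f ?e)) (s(M := Suc (f ?e)))"
        using exec.Inc[of "s(M := f ?e)" M B] by simp
    qed
  qed
  then have "implemented N (Suc (Suc d)) (\<lambda>e. Suc (f e))"
    using implemented_local[OF f] unfolding implemented_def local_fun_def by (metis (no_types))
  then show ?thesis unfolding linspace_def by blast
qed

lemma linspace_const: "linspace (\<lambda>e. c)"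
  by (induction c) (auto intro: linspace_0 linspace_Suc)

lemma esize_rename: "\<exists>N' d. \<forall>e. esize N (\<lambda>i. e (\<sigma> i)) \<le> esize N' e ^ d"
proof -
  have "poly_bounded (\<lambda>e. esize N (\<lambda>i. e (\<sigma> i)))"
    unfolding esize_def
    by (induction N) (auto intro: poly_bounded_intros simp: add.assoc[symmetric] simp del: add_2_eq_Suc)
  then show ?thesis unfolding poly_bounded_def .
qed

lemma linspace_rename:
  assumes "linspace f"
  shows "linspace (\<lambda>e. f (\<lambda>i. e (\<sigma> i)))"
proof -
  obtain N d where f: "implemented N d f" using assms unfolding linspace_def by blast
  obtain N1 d1 where b: "\<And>e. esize N (\<lambda>i. e (\<sigma> i)) \<le> esize N1 e ^ d1"
    using esize_rename[of N \<sigma>] by blast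
  obtain N2 where N2: "\<And>i. i < N \<Longrightarrow> \<sigma> i < N2"
    using finite_nat_set_iff_bounded[of "\<sigma> ` {..<N}"] by auto
  define N' where "N' = max N1 N2"
  have b': "esize N (\<lambda>i. e (\<sigma> i)) ^ d \<le> esize N' e ^ (d1 * d)" for e
    unfolding power_mult
    by (intro power_mono order_trans[OF b] esize_power_mono) (auto simp: N'_def)
  have "implemented N' (d1 * d) (\<lambda>e. f (\<lambda>i. e (\<sigma> i)))"
    unfolding implemented_def
  proof (intro conjI allI impI)
    show "local_fun N' (\<lambda>e. f (\<lambda>i. e (\<sigma> i)))"
      using implemented_local[OF f] N2 unfolding local_fun_def N'_def by (simp add: less_max_iff_disj)
  next
    fix \<rho> :: "nat \<Rightarrow> nat" and M assume "\<forall>i<N'. \<rho> i < M"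
    then have "\<forall>i<N. \<rho> (\<sigma> i) < M" using N2 by (simp add: N'_def less_max_iff_disj)
    then obtain c where c: "computes N d (\<lambda>i. \<rho> (\<sigma> i)) M c f" by (rule implementedE[OF f])
    show "\<exists>c. computes N' (d1 * d) \<rho> M c (\<lambda>e. f (\<lambda>i. e (\<sigma> i)))"
      by (intro exI[of _ c] computesI computesD[OF c] order_trans[OF b']) auto
  qed
  then show ?thesis unfolding linspace_def by blast
qed

text \<open>Limited recursion. Every intermediate value occupies a register, so the bound
  \<open>h\<close> is demanded at all stages, while \<open>h\<close> itself is not computed.
  Register \<open>M\<close> holds the value, \<open>M + 1\<close> the number of rounds left,
  \<open>M + 2\<close> the round and \<open>M + 3\<close> the result of the step function.\<close>

lemma linspace_rec:
  assumes b: "linspace b" and n: "linspace n"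
    and F: "linspace (\<lambda>e. F (e 0) (e (Suc 0)) (\<lambda>i. e (Suc (Suc i))))"
    and h: "poly_bounded h" and le: "\<And>e i. i \<le> n e \<Longrightarrow> rec_nat (b e) (\<lambda>i r. F i r e) i \<le> h e"
  shows "linspace (\<lambda>e. rec_nat (b e) (\<lambda>i r. F i r e) (n e))"
proof -
  define F' where "F' = (\<lambda>e. F (e 0) (e (Suc 0)) (\<lambda>i. e (Suc (Suc i))))"
  define R where "R e i = rec_nat (b e) (\<lambda>i r. F i r e) i" for e i
  \<comment> \<open>For the step function, round and accumulator become variables 0 and 1; all
    others move up by two.\<close>
  define ext where "ext i r e = case_nat i (case_nat r e)" for i r and e :: "nat \<Rightarrow> nat"
  have F': "F i r e = F' (ext i r e)" for i r e by (simp add: F'_def ext_def)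
  obtain N1 d1 where 1: "implemented N1 d1 b" using b unfolding linspace_def by blast
  obtain N2 d2 where 2: "implemented N2 d2 n" using n unfolding linspace_def by blast
  obtain N3 d3 where 3: "implemented N3 d3 F'" using F unfolding linspace_def F'_def by blast
  obtain N4 d4 where 4: "\<And>e. h e \<le> esize N4 e ^ d4" using h unfolding poly_bounded_def by blast
  define N where "N = N1 + N2 + N3 + N4"
  define d where "d = Suc (d1 + d2 + d3 + d4)"
  have bI: "implemented N d b" and nI: "implemented N d n" and FI: "implemented N d F'"
    by (rule implemented_mono[OF 1] implemented_mono[OF 2] implemented_mono[OF 3]; simp add: N_def d_def)+
  have nb: "n e \<le> esize N e ^ d" for e
    using implemented_poly_bounded[OF 2, of e] esize_power_mono[of N2 N "Suc d2" d e]
    unfolding N_def d_def by linarith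
  have hb: "h e \<le> esize N e ^ d" for e
    using 4[of e] esize_power_mono[of N4 N d4 d e] unfolding N_def d_def by linarith
  have Rb: "R e i \<le> esize N e ^ d" if "i \<le> n e" for e i
    using le[OF that] hb[of e] unfolding R_def by linarith
  \<comment> \<open>The extended environment has size at most \<open>esize N e ^ (d + 2)\<close>,
    and the step function needs the \<open>d\<close>-th power of that size.\<close>
  define D where "D = (d + 2) * d"
  have dD: "d \<le> D" by (simp add: D_def)
  have ext_le: "esize N (ext i (R e i) e) ^ d \<le> esize N e ^ D" if "i \<le> n e" for i e
  proof -
    have "(\<Sum>k<m. ext i r e k) \<le> i + r + (\<Sum>k<m. e k)" for m r
    proof -
      have "(\<Sum>k<Suc (Suc m). ext i r e k) = i + r + (\<Sum>k<m. e k)" for m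
        by (induction m) (auto simp: ext_def)
      moreover have "(\<Sum>k<m. ext i r e k) \<le> (\<Sum>k<Suc (Suc m). ext i r e k)" by simp
      ultimately show ?thesis by simp
    qed
    then have "esize N (ext i (R e i) e) \<le> i + R e i + esize N e"
      by (simp add: esize_def)
    also have "\<dots> \<le> esize N e ^ d + esize N e ^ d + esize N e ^ d"
      using that nb[of e] Rb[OF that] esize_power_mono[of N N 1 d e]
      by (intro add_mono) (auto simp: d_def)
    also have "\<dots> \<le> 2 * 2 * esize N e ^ d" by simp
    also have "\<dots> \<le> esize N e * esize N e * esize N e ^ d"
      by (intro mult_mono esize_ge_2) auto
    also have "\<dots> = esize N e ^ (d + 2)" by (simp add: algebra_simps)
    finally show ?thesis unfolding D_def power_mult by (intro power_mono) auto
  qed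
  have locF: "F' e = F' e'" if "\<forall>k<N. e k = e' k" for e e'
    by (rule local_funD[OF implemented_local[OF FI]]) (use that in blast)
  have locn: "n e = n e'" if "\<forall>k<N. e k = e' k" for e e'
    by (rule local_funD[OF implemented_local[OF nI]]) (use that in blast)
  have locb: "b e = b e'" if "\<forall>k<N. e k = e' k" for e e'
    by (rule local_funD[OF implemented_local[OF bI]]) (use that in blast)
  have "implemented N D (\<lambda>e. R e (n e))"
    unfolding implemented_def
  proof (intro conjI allI impI)
    show "local_fun N (\<lambda>e. R e (n e))"
      unfolding local_fun_def
    proof (intro allI impI)
      fix e e' :: "nat \<Rightarrow> nat" assume eq: "\<forall>i<N. e i = e' i"
      have "R e i = R e' i" for i
      proof (induction i)
        case 0
        show ?case using locb[OF eq] by (simp add: R_def)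
      next
        case (Suc i)
        have "F' (ext i (R e i) e) = F' (ext i (R e i) e')"
          using eq by (intro locF) (auto simp: ext_def split: nat.split)
        with Suc show ?case by (simp add: R_def F')
      qed
      then show "R e (n e) = R e' (n e')" using locn[OF eq] by simp
    qed
  next
    fix \<rho> :: "nat \<Rightarrow> nat" and M assume \<rho>: "\<forall>i<N. \<rho> i < M"
    define \<rho>' where "\<rho>' = case_nat (M + 2) (case_nat M \<rho>)"
    have \<rho>': "\<forall>i<N. \<rho>' i < M + 3"
    proof (intro allI impI)
      fix i assume "i < N"
      consider "i = 0" | "i = Suc 0" | j where "i = Suc (Suc j)" by (metis nat.exhaust)
      then show "\<rho>' i < M + 3"
      proof cases
        case 3
        then have "\<rho> j < M" using \<rho> \<open>i < N\<close> by simp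
        then show ?thesis by (simp add: \<rho>'_def 3)
      qed (auto simp: \<rho>'_def)
    qed
    obtain cb where cb: "computes N d \<rho> M cb b" by (rule implementedE[OF bI \<rho>])
    have \<rho>1: "\<forall>i<N. \<rho> i < M + 1" using \<rho> by auto
    obtain cn where cn: "computes N d \<rho> (M + 1) cn n" by (rule implementedE[OF nI \<rho>1])
    obtain cF where cF: "computes N d \<rho>' (M + 3) cF F'" by (rule implementedE[OF FI \<rho>'])
    define body where "body = Seq (Dec (M + 1)) (Seq cF (Seq (While M (Dec M))
       (Seq (While (M + 3) (Seq (Dec (M + 3)) (Inc M))) (Inc (M + 2)))))"
    show "\<exists>c. computes N D \<rho> M c (\<lambda>e. R e (n e))"
    proof (rule exI[of _ "Seq cb (Seq cn (Seq (While (M + 1) body) (While (M + 2) (Dec (M + 2)))))"],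
        rule computesI)
      fix s :: "nat \<Rightarrow> nat" and B
      assume s: "\<forall>r\<ge>M. s r = 0" "\<forall>r. s r \<le> B" and B: "esize N (\<lambda>i. s (\<rho> i)) ^ D \<le> B"
      define e where "e = (\<lambda>i. s (\<rho> i))"
      have Bd: "esize N e ^ d \<le> B"
        using B esize_power_mono[of N N d D e] dD unfolding e_def by linarith
      \<comment> \<open>Loop invariant: the registers before round \<open>i\<close>.\<close>
      define S where "S i = s(M := R e i, M + 1 := n e - i, M + 2 := i)" for i
      have R0: "b e = R e 0" by (simp add: R_def)
      have RB: "R e i \<le> B" if "i \<le> n e" for i using Rb[OF that] Bd by linarith
      have nB: "n e \<le> B" using nb[of e] Bd by linarith
      have same: "\<forall>k<N. (s(M := x)) (\<rho> k) = e k" for x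
        using \<rho> by (auto simp: e_def)
      have 1: "exec B cb s (s(M := R e 0))"
        using computesD[OF cb s] Bd unfolding e_def[symmetric] R0 by blast
      have "exec B cn (s(M := R e 0)) ((s(M := R e 0))(M + 1 := n (\<lambda>i. (s(M := R e 0)) (\<rho> i))))"
        using s RB[of 0] esize_cong[of N "\<lambda>i. (s(M := R e 0)) (\<rho> i)" e] same[of "R e 0"] Bd
        by (intro computesD[OF cn]) auto
      moreover have "(s(M := R e 0))(M + 1 := n (\<lambda>i. (s(M := R e 0)) (\<rho> i))) = S 0"
        using locn[OF same[of "R e 0"]] s by (auto simp: S_def fun_eq_iff)
      ultimately have 2: "exec B cn (s(M := R e 0)) (S 0)" by simp
      have step: "exec B body (S i) (S (Suc i))" if i: "i < n e" for i
      proof -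
        let ?s1 = "(S i)(M + 1 := n e - Suc i)"
        let ?x = "R e (Suc i)"
        have a: "exec B (Dec (M + 1)) (S i) ?s1"
          using exec.Dec[of "S i" "M + 1" B] i by (simp add: S_def)
        have same': "\<forall>k<N. ?s1 (\<rho>' k) = ext i (R e i) e k"
        proof (intro allI impI)
          fix k assume "k < N"
          consider "k = 0" | "k = Suc 0" | j where "k = Suc (Suc j)" by (metis nat.exhaust)
          then show "?s1 (\<rho>' k) = ext i (R e i) e k"
          proof cases
            case 3
            then have "\<rho> j < M" using \<rho> \<open>k < N\<close> by simp
            then show ?thesis by (simp add: \<rho>'_def 3 ext_def S_def e_def)
          qed (auto simp: \<rho>'_def ext_def S_def)
        qed
        have "F' (\<lambda>k. ?s1 (\<rho>' k)) = ?x"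
          using locF[OF same'] by (simp add: R_def F')
        moreover have "exec B cF ?s1 (?s1(M + 3 := F' (\<lambda>k. ?s1 (\<rho>' k))))"
        proof (rule computesD[OF cF])
          show "\<forall>r\<ge>M + 3. ?s1 r = 0" using s by (auto simp: S_def)
          show "\<forall>r. ?s1 r \<le> B" using s RB[of i] nB i by (auto simp: S_def)
          show "esize N (\<lambda>k. ?s1 (\<rho>' k)) ^ d \<le> B"
            using esize_cong[of N "\<lambda>k. ?s1 (\<rho>' k)" "ext i (R e i) e"] same' ext_le[of i e] i
              B[folded e_def] by simp
        qed
        ultimately have b: "exec B cF ?s1 (?s1(M + 3 := ?x))" by simp
        have c: "exec B (While M (Dec M)) (?s1(M + 3 := ?x)) (?s1(M + 3 := ?x, M := 0))"
          by (rule exec_clear)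
        let ?s2 = "?s1(M + 3 := ?x, M := 0)"
        have "exec B (While (M + 3) (Seq (Dec (M + 3)) (Inc M))) ?s2 (?s2(M + 3 := 0, M := ?s2 (M + 3) + ?s2 M))"
          using RB[of "Suc i"] i by (intro exec_move) auto
        moreover have "?s2(M + 3 := 0, M := ?s2 (M + 3) + ?s2 M) = ?s1(M := ?x)"
          using s by (auto simp: S_def fun_eq_iff)
        ultimately have d: "exec B (While (M + 3) (Seq (Dec (M + 3)) (Inc M))) ?s2 (?s1(M := ?x))"
          by simp
        have "exec B (Inc (M + 2)) (?s1(M := ?x)) ((?s1(M := ?x))(M + 2 := (?s1(M := ?x)) (M + 2) + 1))"
          using i nB by (intro exec.Inc) (auto simp: S_def)
        moreover have "(?s1(M := ?x))(M + 2 := (?s1(M := ?x)) (M + 2) + 1) = S (Suc i)"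
          by (auto simp: S_def fun_eq_iff)
        ultimately have f: "exec B (Inc (M + 2)) (?s1(M := ?x)) (S (Suc i))" by simp
        show ?thesis unfolding body_def by (rule exec.Seq[OF a exec.Seq[OF b exec.Seq[OF c exec.Seq[OF d f]]]])
      qed
      have "exec B (While (M + 1) body) (S i) (S (n e))" if "i \<le> n e" for i
        using that
      proof (induction "n e - i" arbitrary: i)
        case 0
        then have "i = n e" by simp
        moreover have "S (n e) (M + 1) = 0" by (simp add: S_def)
        ultimately show ?case by (simp only: exec.WhileF)
      next
        case (Suc k)
        then have i: "i < n e" by simp
        show ?case
          by (rule exec.WhileT[OF _ step[OF i] Suc(1)]) (use Suc i in \<open>auto simp: S_def\<close>)
      qed
      then have 3: "exec B (While (M + 1) body) (S 0) (S (n e))" by simp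
      have "exec B (While (M + 2) (Dec (M + 2))) (S (n e)) ((S (n e))(M + 2 := 0))"
        by (rule exec_clear)
      moreover have "(S (n e))(M + 2 := 0) = s(M := R e (n e))"
        using s by (auto simp: S_def fun_eq_iff)
      ultimately have 4: "exec B (While (M + 2) (Dec (M + 2))) (S (n e)) (s(M := R e (n e)))" by simp
      show "exec B (Seq cb (Seq cn (Seq (While (M + 1) body) (While (M + 2) (Dec (M + 2)))))) s
          (s(M := R (\<lambda>i. s (\<rho> i)) (n (\<lambda>i. s (\<rho> i)))))"
        using exec.Seq[OF 1 exec.Seq[OF 2 exec.Seq[OF 3 4]]] unfolding e_def .
    qed
  qed
  then show ?thesis unfolding linspace_def R_def by blast
qed

text \<open>A polynomial in the input values is exponential in the input length with a linear
  exponent, so numerals below it have linear length.\<close>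

theorem linspace_E2:
  assumes f: "linspace f" and m: "0 < m"
    and F: "\<And>ws e. length ws = m \<Longrightarrow> (\<And>i. i < m \<Longrightarrow> e i = wnum (ws ! i)) \<Longrightarrow> f e = wnum (F ws)"
  shows "F \<in> E2 m"
proof -
  obtain N d where I: "implemented N d f" using f unfolding linspace_def by blast
  \<comment> \<open>The program may formally read \<open>N > m\<close> variables, whereas the first
    \<open>m\<close> already determine the value through \<open>F\<close>; the surplus variables all
    read the last input.\<close>
  define \<rho> where "\<rho> i = min i (m - 1)" for i
  have \<rho>: "\<forall>i<N. \<rho> i < m" using m by (auto simp: \<rho>_def)
  obtain c where c: "computes N d \<rho> m c f" by (rule implementedE[OF I \<rho>])
  obtain n0 where n0: "\<And>r. r \<in> regs c \<Longrightarrow> r < n0"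
    using finite_regs[of c] finite_nat_set_iff_bounded by auto
  define n where "n = n0 + m + 1"
  have n: "\<And>r. r \<in> regs c \<Longrightarrow> r < n" "0 < n" "m < n"
    by (auto simp: n_def dest: n0)
  obtain N' d' where Nd: "\<And>e. esize N (\<lambda>i. e (\<rho> i)) \<le> esize N' e ^ d'"
    using esize_rename[of N \<rho>] by blast
  define D where "D = d' * d + 1"
  \<comment> \<open>The heads visit at most \<open>n * (b + 2)\<close> cells, where
    \<open>b = 3 * D * (?L + m + 1) + 1\<close> and
    \<open>?L + m + 1 \<le> (m + 2) * (?L + 1)\<close>.\<close>
  define K where "K = n * (3 * D * (m + 2) + 3)"
  let ?M = "machine n c"
  have "\<exists>t. fst (run ?M ws t) = halt ?M \<and> fst (snd (run ?M ws t)) m = word_tape (F ws) \<and>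
      space_used ?M ws t \<le> K * (sum_list (map length ws) + 1)" if ws: "length ws = m" for ws
  proof -
    let ?L = "sum_list (map length ws)"
    define s where "s i = (if i < m then wnum (ws ! i) else 0)" for i
    define B where "B = (8 :: nat) ^ (D * (?L + m + 1))"
    \<comment> \<open>The shift by 2 turns a sum into a product,
      \<open>a + b + 2 \<le> (a + 2) * (b + 2)\<close>, to which \<open>wnum_le\<close> applies
      factor by factor.\<close>
    have prod: "sum_list (map wnum us) + 2 \<le> 8 ^ (sum_list (map length us) + length us + 1)" for us
    proof (induction us)
      case (Cons u us)
      have "(wnum u + 2) * (sum_list (map wnum us) + 2) \<le>
          8 ^ (length u + 1) * 8 ^ (sum_list (map length us) + length us + 1)"
        by (intro mult_mono wnum_le Cons) auto
      then show ?case by (simp add: power_add algebra_simps)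
    qed simp
    have sum: "esize N' s \<le> 8 ^ (?L + m + 1)"
    proof -
      have "(\<Sum>i<N'. s i) \<le> (\<Sum>i<N' + m. s i)" by (intro sum_mono2) auto
      also have "\<dots> = (\<Sum>i<m. s i)"
        by (intro sum.mono_neutral_right) (auto simp: s_def)
      also have "\<dots> = sum_list (map wnum ws)"
        by (simp add: s_def sum_list_sum_nth ws atLeast0LessThan)
      finally show ?thesis using prod[of ws] ws by (simp add: esize_def)
    qed
    have le1: "esize N (\<lambda>i. s (\<rho> i)) ^ d \<le> B"
    proof -
      have "esize N (\<lambda>i. s (\<rho> i)) ^ d \<le> (esize N' s ^ d') ^ d" by (intro power_mono Nd) auto
      also have "\<dots> = esize N' s ^ (d' * d)" by (simp add: power_mult)
      also have "\<dots> \<le> (8 ^ (?L + m + 1)) ^ (d' * d)" by (intro power_mono sum) auto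
      also have "\<dots> \<le> B" unfolding B_def D_def power_mult[symmetric] by (intro power_increasing) auto
      finally show ?thesis .
    qed
    have le2: "\<forall>r. s r \<le> B"
    proof
      fix r
      have "s r \<le> 8 ^ (?L + m + 1)"
      proof (cases "r < m")
        case True
        then have "wnum (ws ! r) \<le> sum_list (map wnum ws)"
          using ws by (intro member_le_sum_list) auto
        with True show ?thesis using prod[of ws] ws by (simp add: s_def)
      qed (simp add: s_def)
      also have "\<dots> \<le> B" unfolding B_def D_def by (intro power_increasing) auto
      finally show "s r \<le> B" .
    qed
    define b where "b = 3 * D * (?L + m + 1) + 1"
    have len: "length (nword v) \<le> b" if "v \<le> B" for v
    proof -
      have "(2::nat) ^ length (nword v) \<le> B + 1"
        using wnum_ge[of "nword v"] that by simp
      also have "\<dots> \<le> 2 * B" by (simp add: B_def)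
      also have "B = 2 ^ (3 * D * (?L + m + 1))"
        unfolding B_def mult.assoc power_mult[of 2 3] by simp
      finally have "(2::nat) ^ length (nword v) \<le> 2 ^ b" by (simp add: b_def)
      then show ?thesis by (simp add: power_le_imp_le_exp)
    qed
    have out: "f (\<lambda>i. s (\<rho> i)) = wnum (F ws)"
      using ws m by (intro F) (auto simp: s_def \<rho>_def)
    have "exec B c s (s(m := wnum (F ws)))"
      unfolding out[symmetric] by (rule computesD[OF c _ le2 le1]) (simp add: s_def)
    from reach_exec[OF this _ n(1,2), of "int b" c "[]"] le2 len
    have "reach ?M (int b) (to_nat ([c], Work), \<lambda>i. word_tape (nword (s i)), \<lambda>_. 0)
        (to_nat ([] :: com list, Work), \<lambda>i. word_tape (nword ((s(m := wnum (F ws))) i)), \<lambda>_. 0)"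
      by auto
    moreover have "init ?M ws = (to_nat ([c], Work), \<lambda>i. word_tape (nword (s i)), \<lambda>_. 0)"
      using ws by (auto simp: init_def machine_def s_def fun_eq_iff)
    ultimately obtain t where
      t: "run ?M ws t = (to_nat ([] :: com list, Work), \<lambda>i. word_tape (nword ((s(m := wnum (F ws))) i)), \<lambda>_. 0)"
      and heads: "\<And>s i. s \<le> t \<Longrightarrow> - 1 \<le> snd (snd (run ?M ws s)) i \<and> snd (snd (run ?M ws s)) i \<le> int b"
      using reach_steps unfolding run_def by (metis (no_types, lifting))
    have "{(i, snd (snd (run ?M ws s)) i) | i s. i < ntapes ?M \<and> s \<le> t} \<subseteq> {..<n} \<times> {- 1..int b}"
      using heads by (auto simp: machine_def)
    then have "space_used ?M ws t \<le> card ({..<n} \<times> {- 1..int b})"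
      unfolding space_used_def by (intro card_mono) auto
    also have "\<dots> = n * (b + 2)" by (simp add: card_cartesian_product nat_add_distrib)
    also have "\<dots> \<le> K * (?L + 1)"
    proof -
      have "3 * D * (?L + m + 1) \<le> 3 * D * ((m + 2) * (?L + 1))" by (intro mult_le_mono) auto
      then have "b + 2 \<le> (3 * D * (m + 2) + 3) * (?L + 1)"
        by (simp add: b_def algebra_simps)
      then show ?thesis unfolding K_def mult.assoc by (intro mult_le_mono) auto
    qed
    finally show ?thesis using t by (intro exI[of _ t]) (simp add: machine_def)
  qed
  moreover have "wf_mtm ?M" using n by (intro wf_machine)
  moreover have "ntapes ?M = n" by (simp add: machine_def)
  ultimately show ?thesis using n(3) unfolding E2_def mem_Collect_eq
    by (intro exI[of _ ?M] exI[of _ K]) simp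
qed

section \<open>Arithmetic\<close>

lemma poly_bounded_power: "poly_bounded f \<Longrightarrow> poly_bounded (\<lambda>e. f e ^ d)"
  by (induction d) (auto intro: poly_bounded_intros)

lemma poly_bounded_esize: "poly_bounded (esize N)"
  unfolding poly_bounded_def by (intro exI[of _ N] exI[of _ 1]) simp

lemma esize_case_nat: "esize N (case_nat x e) \<le> x + esize N e"
proof -
  have "(\<Sum>i<N. case_nat x e i) \<le> (\<Sum>i<Suc N. case_nat x e i)" by simp
  also have "\<dots> = x + (\<Sum>i<N. e i)" by (simp add: sum.lessThan_Suc_shift del: sum.lessThan_Suc)
  finally show ?thesis by (simp add: esize_def)
qed

lemma poly_bounded_let:
  assumes g: "poly_bounded g" and F: "poly_bounded (\<lambda>e. F (e 0) (\<lambda>i. e (Suc i)))"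
  shows "poly_bounded (\<lambda>e. F (g e) e)"
proof -
  obtain N d where "\<And>e. F (e 0) (\<lambda>i. e (Suc i)) \<le> esize N e ^ d"
    using F unfolding poly_bounded_def by blast
  from this[of "case_nat (g _) _"] have le: "F (g e) e \<le> (g e + esize N e) ^ d" for e
    by (auto intro!: order_trans[OF _ power_mono[OF esize_case_nat[of N "g e" e]]])
  have "poly_bounded (\<lambda>e. (g e + esize N e) ^ d)"
    using g by (intro poly_bounded_power poly_bounded_add poly_bounded_esize)
  then show ?thesis using le by (rule poly_bounded_le)
qed

text \<open>Substitution as a recursion with a single round: it starts from \<open>g e\<close> and
  applies \<open>F\<close> once.\<close>

lemma linspace_let:
  assumes g: "linspace g" and F: "linspace (\<lambda>e. F (e 0) (\<lambda>i. e (Suc i)))"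
  shows "linspace (\<lambda>e. F (g e) e)"
proof -
  have "linspace (\<lambda>e. rec_nat (g e) (\<lambda>i r. F r e) (Suc 0))"
  proof (rule linspace_rec[where h = "\<lambda>e. g e + F (g e) e"])
    show "linspace (\<lambda>e. F (e (Suc 0)) (\<lambda>i. e (Suc (Suc i))))"
      using linspace_rename[OF F, of Suc] .
    show "poly_bounded (\<lambda>e. g e + F (g e) e)"
      using linspace_poly_bounded[OF g] linspace_poly_bounded[OF F]
      by (intro poly_bounded_add poly_bounded_let[where F = F])
    show "rec_nat (g e) (\<lambda>i r. F r e) i \<le> g e + F (g e) e" if "i \<le> Suc 0" for e i
      using that by (cases i) auto
  qed (intro g linspace_const)+
  then show ?thesis by simp
qed

lemma linspace_comp1:
  "linspace (\<lambda>e. H (e 0)) \<Longrightarrow> linspace f \<Longrightarrow> linspace (\<lambda>e. H (f e))"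
  by (rule linspace_let[where F = "\<lambda>x e. H x"])

lemma linspace_comp2:
  assumes H: "linspace (\<lambda>e. H (e 0) (e (Suc 0)))" and f: "linspace f" and g: "linspace g"
  shows "linspace (\<lambda>e. H (f e) (g e))"
proof -
  have "linspace (\<lambda>e. H (e (Suc 0)) (e 0))"
    using linspace_rename[OF H, of "\<lambda>i. 1 - i"] by simp
  then have "linspace (\<lambda>e. H (e 0) (g (\<lambda>i. e (Suc i))))"
    using linspace_let[of "\<lambda>e. g (\<lambda>i. e (Suc i))" "\<lambda>y e. H (e 0) y"] linspace_rename[OF g, of Suc] by simp
  then show ?thesis by (rule linspace_let[where F = "\<lambda>x e. H x (g e)", OF f])
qed

named_theorems linspace_intros

declare linspace_var [linspace_intros] linspace_const [linspace_intros] linspace_Suc [linspace_intros]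

lemma linspace_add [linspace_intros]:
  assumes "linspace f" "linspace g"
  shows "linspace (\<lambda>e. f e + g e)"
proof -
  have eq: "rec_nat (f e) (\<lambda>i r. Suc r) n = f e + n" for e n by (induction n) auto
  have "linspace (\<lambda>e. rec_nat (f e) (\<lambda>i r. Suc r) (g e))"
    by (rule linspace_rec[where h = "\<lambda>e. f e + g e"])
      (use assms in \<open>auto simp: eq intro: poly_bounded_intros linspace_poly_bounded linspace_intros\<close>)
  then show ?thesis by (simp add: eq)
qed

lemma linspace_mult [linspace_intros]:
  assumes "linspace f" "linspace g"
  shows "linspace (\<lambda>e. f e * g e)"
proof -
  have eq: "rec_nat 0 (\<lambda>i r. r + f e) n = f e * n" for e n by (induction n) auto
  have "linspace (\<lambda>e. rec_nat 0 (\<lambda>i r. r + f e) (g e))"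
    by (rule linspace_rec[where h = "\<lambda>e. f e * g e"])
      (use assms in \<open>auto simp: eq intro: poly_bounded_intros linspace_poly_bounded linspace_intros linspace_rename\<close>)
  then show ?thesis by (simp add: eq)
qed

lemma linspace_power [linspace_intros]: "linspace f \<Longrightarrow> linspace (\<lambda>e. f e ^ p)"
  by (induction p) (auto intro: linspace_intros)

lemma linspace_diff [linspace_intros]:
  assumes "linspace f" "linspace g"
  shows "linspace (\<lambda>e. f e - g e)"
proof -
  \<comment> \<open>A recursion that returns its round computes the predecessor.\<close>
  have eq1: "rec_nat 0 (\<lambda>i r. i) n = n - 1" for n :: nat by (cases n) auto
  have "linspace (\<lambda>e. rec_nat 0 (\<lambda>i r. i) (e (Suc 0)))"
    by (rule linspace_rec[where h = "\<lambda>e. e (Suc 0)"])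
      (auto simp: eq1 intro: poly_bounded_intros linspace_intros)
  then have pred: "linspace (\<lambda>e. e (Suc 0) - 1)" by (simp add: eq1)
  have eq: "rec_nat (f e) (\<lambda>i r. r - 1) n = f e - n" for e n by (induction n) auto
  have "linspace (\<lambda>e. rec_nat (f e) (\<lambda>i r. r - 1) (g e))"
    by (rule linspace_rec[where h = f])
      (use assms pred in \<open>auto simp: eq simp del: One_nat_def intro: linspace_poly_bounded\<close>)
  then show ?thesis unfolding eq .
qed

section \<open>Decidable conditions and bounded search\<close>

definition linspace_pred :: "((nat \<Rightarrow> nat) \<Rightarrow> bool) \<Rightarrow> bool" where
  "linspace_pred P \<longleftrightarrow> linspace (\<lambda>e. of_bool (P e))"

text \<open>The truth value is the number of rounds: without a round the value of \<open>g\<close>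
  remains, one round replaces it by that of \<open>f\<close>.\<close>

lemma linspace_if [linspace_intros]:
  assumes "linspace_pred P" "linspace f" "linspace g"
  shows "linspace (\<lambda>e. if P e then f e else g e)"
proof -
  have eq: "rec_nat (g e) (\<lambda>i r. f e) n = (if n = 0 then g e else f e)" for e n by (cases n) auto
  have "linspace (\<lambda>e. rec_nat (g e) (\<lambda>i r. f e) (of_bool (P e)))"
    by (rule linspace_rec[where h = "\<lambda>e. f e + g e"])
      (use assms in \<open>auto simp: eq linspace_pred_def
         intro: poly_bounded_intros linspace_poly_bounded linspace_intros linspace_rename\<close>)
  moreover have "rec_nat (g e) (\<lambda>i r. f e) (of_bool (P e)) = (if P e then f e else g e)" for e
    by (simp add: eq)
  ultimately show ?thesis by simp
qed

lemma linspace_pred_not [linspace_intros]: "linspace_pred P \<Longrightarrow> linspace_pred (\<lambda>e. \<not> P e)"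
proof -
  assume P: "linspace_pred P"
  have "of_bool (\<not> P e) = 1 - (of_bool (P e) :: nat)" for e by simp
  then show ?thesis using P unfolding linspace_pred_def by (simp only:) (intro linspace_intros)
qed

lemma linspace_pred_conj [linspace_intros]:
  "linspace_pred P \<Longrightarrow> linspace_pred Q \<Longrightarrow> linspace_pred (\<lambda>e. P e \<and> Q e)"
  unfolding linspace_pred_def of_bool_conj by (intro linspace_intros)

lemma linspace_pred_disj [linspace_intros]:
  "linspace_pred P \<Longrightarrow> linspace_pred Q \<Longrightarrow> linspace_pred (\<lambda>e. P e \<or> Q e)"
  using linspace_pred_not[OF linspace_pred_conj[OF linspace_pred_not linspace_pred_not]] by auto

lemma linspace_pred_le [linspace_intros]:
  assumes "linspace f" "linspace g"
  shows "linspace_pred (\<lambda>e. f e \<le> g e)"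
proof -
  have "of_bool (f e \<le> g e) = 1 - (f e - g e)" for e by auto
  then show ?thesis unfolding linspace_pred_def by (simp only:) (intro linspace_intros assms)
qed

lemma linspace_pred_eq [linspace_intros]:
  assumes "linspace f" "linspace g"
  shows "linspace_pred (\<lambda>e. f e = g e)"
  unfolding order_eq_iff by (intro linspace_intros assms)

text \<open>The greatest \<open>i \<le> n\<close> with \<open>P i\<close>, since later hits
  overwrite earlier ones, and 0 if there is none. The value never exceeds \<open>n\<close>, so
  functions found by search are bounded automatically.\<close>

definition bmax :: "(nat \<Rightarrow> bool) \<Rightarrow> nat \<Rightarrow> nat" where
  "bmax P n = rec_nat 0 (\<lambda>i r. if P i then i else r) (Suc n)"

lemma bmax_eqI: "P a \<Longrightarrow> a \<le> n \<Longrightarrow> (\<And>b. P b \<Longrightarrow> b \<le> n \<Longrightarrow> b \<le> a) \<Longrightarrow> bmax P n = a"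
proof (induction n)
  case 0
  then show ?case by (simp add: bmax_def)
next
  case (Suc n)
  show ?case
  proof (cases "a = Suc n")
    case True
    then show ?thesis using Suc.prems(1) by (simp add: bmax_def)
  next
    case False
    then have "a \<le> n" "\<not> P (Suc n)" using Suc.prems(2) Suc.prems(3)[of "Suc n"] by auto
    then show ?thesis using Suc by (simp add: bmax_def)
  qed
qed

lemma linspace_bmax [linspace_intros]:
  assumes P: "linspace_pred (\<lambda>e. P (e 0) (\<lambda>i. e (Suc i)))" and n: "linspace n"
  shows "linspace (\<lambda>e. bmax (\<lambda>i. P i e) (n e))"
proof -
  have le: "rec_nat 0 (\<lambda>i r. if P i e then i else r) n \<le> n" for e n
    by (induction n) auto
  \<comment> \<open>Inside the recursion variable 1 is the accumulator, which \<open>P\<close> must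
    skip.\<close>
  have "linspace_pred (\<lambda>e. P (e 0) (\<lambda>i. e (Suc (Suc i))))"
    using linspace_rename[OF P[unfolded linspace_pred_def], of "case_nat 0 (\<lambda>i. Suc (Suc i))"]
    unfolding linspace_pred_def by simp
  then show ?thesis unfolding bmax_def
    by (intro linspace_rec[where h = "\<lambda>e. n e + 1"] linspace_intros n poly_bounded_intros
        linspace_poly_bounded) (auto intro: order_trans[OF le])
qed

lemma linspace_pred_bex [linspace_intros]:
  assumes P: "linspace_pred (\<lambda>e. P (e 0) (\<lambda>i. e (Suc i)))" and n: "linspace n"
  shows "linspace_pred (\<lambda>e. \<exists>i\<le>n e. P i e)"
proof -
  have eq: "rec_nat 0 (\<lambda>i r. if P i e then 1 else r) n = of_bool (\<exists>i<n. P i e)" for e n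
    by (induction n) (auto simp: less_Suc_eq)
  have "linspace_pred (\<lambda>e. P (e 0) (\<lambda>i. e (Suc (Suc i))))"
    using linspace_rename[OF P[unfolded linspace_pred_def], of "case_nat 0 (\<lambda>i. Suc (Suc i))"]
    unfolding linspace_pred_def by simp
  then have "linspace (\<lambda>e. rec_nat 0 (\<lambda>i r. if P i e then 1 else r) (Suc (n e)))"
    by (intro linspace_rec[where h = "\<lambda>e. 1"] linspace_intros n poly_bounded_intros) (simp_all add: eq)
  then show ?thesis unfolding eq linspace_pred_def less_Suc_eq_le .
qed

lemma linspace_div [linspace_intros]:
  assumes "linspace f" "linspace g"
  shows "linspace (\<lambda>e. f e div g e)"
proof -
  have "bmax (\<lambda>q. q * b \<le> a) a = a div b" if "b > 0" for a b :: nat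
    using that by (intro bmax_eqI) (auto simp: less_eq_div_iff_mult_less_eq)
  \<comment> \<open>For \<open>b = 0\<close> the search would return \<open>a\<close>.\<close>
  then have "a div b = (if b = 0 then 0 else bmax (\<lambda>q. q * b \<le> a) a)" for a b :: nat by simp
  then have "linspace (\<lambda>e. e 0 div e (Suc 0))"
    by (simp only:) (intro linspace_intros)
  then show ?thesis using assms by (rule linspace_comp2)
qed

lemma linspace_mod [linspace_intros]:
  "linspace f \<Longrightarrow> linspace g \<Longrightarrow> linspace (\<lambda>e. f e mod g e)"
  unfolding minus_mult_div_eq_mod[symmetric] by (intro linspace_intros)

section \<open>Codes of numbers\<close>

lemma code_nat_0: "code_nat 0 = [D0]" and code_nat_1: "code_nat (Suc 0) = [D1]"
  by (simp_all add: code_nat.simps)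

lemma code_nat_step:
  "1 < n \<Longrightarrow> code_nat n = code_nat (n div 2) @ [if even n then D0 else D1]"
  by (subst code_nat.simps) simp

text \<open>The numerical form of writing a code in front of a word. The first letter is the least
  significant digit, while \<open>code_nat\<close> lists the high bits first, so the bits of
  \<open>c\<close> are prepended from the lowest one on.\<close>

definition prep :: "nat \<Rightarrow> nat \<Rightarrow> nat" where
  "prep c y = wnum (code_nat c @ nword y)"

lemma nword_digit: "nword (digit x + 6 * y) = x # nword y"
  using nword_wnum[of "x # nword y"] by simp

lemma prep_step:
  assumes "1 < c"
  shows "prep c y = prep (c div 2) (1 + c mod 2 + 6 * y)"
proof -
  have "nword (1 + c mod 2 + 6 * y) = (if even c then D0 else D1) # nword y"
    using nword_digit[of D0 y] nword_digit[of D1 y] by (auto simp: odd_iff_mod_2_eq_one)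
  then show ?thesis using assms by (simp add: prep_def code_nat_step)
qed

lemma prep_0: "prep 0 y = 1 + 6 * y"
  by (simp add: prep_def code_nat_0 code_nat_1)

lemma prep_1: "prep (Suc 0) y = 2 + 6 * y"
  by (simp add: prep_def code_nat_0 code_nat_1)

lemma rec_nat_shift: "rec_nat y f (Suc j) = rec_nat (f 0 y) (\<lambda>i. f (Suc i)) j"
  by (induction j) auto

text \<open>Round \<open>i\<close> prepends bit \<open>i\<close> of \<open>c\<close> and idles once
  the bits are exhausted, so any number of rounds from \<open>c\<close> on gives the same
  result.\<close>

definition pstep :: "nat \<Rightarrow> nat \<Rightarrow> nat \<Rightarrow> nat" where
  "pstep c i r = (if c div 2 ^ i = 0 then r else 1 + (c div 2 ^ i) mod 2 + 6 * r)"

text \<open>\<open>c = 0\<close> is excluded because its code is the letter \<open>D0\<close>,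
  whereas the loop would prepend nothing.\<close>

lemma prep_conv_rec:
  assumes "0 < c" "c \<le> j"
  shows "rec_nat y (pstep c) j = prep c y"
  using assms
proof (induction c arbitrary: y j rule: less_induct)
  case (less c)
  obtain j' where j: "j = Suc j'" using less.prems by (cases j) auto
  have "pstep c (Suc i) = pstep (c div 2) i" for i
    by (auto simp: pstep_def fun_eq_iff div_mult2_eq)
  then have rec: "rec_nat y (pstep c) j = rec_nat (1 + c mod 2 + 6 * y) (pstep (c div 2)) j'"
    unfolding j rec_nat_shift using less.prems by (simp add: pstep_def)
  show ?case
  proof (cases "c = 1")
    case True
    have "rec_nat z (pstep 0) i = z" for z i by (induction i) (auto simp: pstep_def)
    with True show ?thesis unfolding rec by (simp add: prep_1)
  next
    case False
    then have c: "1 < c" using less.prems by simp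
    have "rec_nat (1 + c mod 2 + 6 * y) (pstep (c div 2)) j' = prep (c div 2) (1 + c mod 2 + 6 * y)"
      using less.prems c j by (intro less.IH) auto
    with c show ?thesis unfolding rec by (simp add: prep_step)
  qed
qed

text \<open>Each bit multiplies \<open>y + 1\<close> by at most 8 = 2 ^ 3, and \<open>c\<close> at
  least doubles with each further bit; hence the cube.\<close>

lemma prep_le: "0 < c \<Longrightarrow> prep c y + 1 \<le> 8 * c ^ 3 * (y + 1)"
proof (induction c arbitrary: y rule: less_induct)
  case (less c)
  show ?case
  proof (cases "c = 1")
    case True
    then show ?thesis by (simp add: prep_1)
  next
    case False
    then have c: "1 < c" using less.prems by simp
    have "prep c y + 1 \<le> 8 * (c div 2) ^ 3 * ((1 + c mod 2 + 6 * y) + 1)"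
      using c less.IH[of "c div 2" "1 + c mod 2 + 6 * y"] by (simp add: prep_step)
    also have "\<dots> \<le> 8 * (c div 2) ^ 3 * (8 * (y + 1))"
      by (intro mult_le_mono2) (use mod_less_divisor[of 2 c] in auto)
    also have "\<dots> = 8 * (2 * (c div 2)) ^ 3 * (y + 1)" by (simp add: power_mult_distrib algebra_simps)
    also have "\<dots> \<le> 8 * c ^ 3 * (y + 1)"
      by (intro mult_le_mono power_mono) auto
    finally show ?thesis .
  qed
qed

lemma linspace_prep [linspace_intros]:
  assumes "linspace f" "linspace g"
  shows "linspace (\<lambda>e. prep (f e) (g e))"
proof -
  \<comment> \<open>\<open>2 ^ n\<close> is not polynomially bounded, so the quotient is obtained by
    halving \<open>n\<close> times.\<close>
  have eq: "rec_nat a (\<lambda>i r. r div 2) n = a div 2 ^ n" for a n :: nat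
    by (induction n) (auto simp: div_mult2_eq[symmetric] mult.commute)
  have "linspace (\<lambda>e. rec_nat (e 0) (\<lambda>i r. r div 2) (e (Suc 0)))"
    by (rule linspace_rec[where h = "\<lambda>e. e 0"])
      (auto simp: eq intro: linspace_intros poly_bounded_intros)
  then have "linspace (\<lambda>e. e 0 div 2 ^ e (Suc 0))" by (simp add: eq)
  note halves = linspace_comp2[where H = "\<lambda>a n. a div 2 ^ n", OF this]
  have mono: "rec_nat y (pstep c) i \<le> rec_nat y (pstep c) j" if "i \<le> j" for y c i j
    using that by (induction j) (auto simp: le_Suc_eq pstep_def intro: order_trans)
  have le: "rec_nat y (pstep c) i \<le> y + 8 * c ^ 3 * (y + 1)" if "i \<le> c" for y c i
    using mono[OF that, of y c] prep_conv_rec[of c c y] prep_le[of c y] that by (cases "c = 0") auto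
  have "linspace (\<lambda>e. rec_nat (e (Suc 0)) (\<lambda>i r. pstep (e 0) i r) (e 0))"
  proof (rule linspace_rec[where h = "\<lambda>e. e (Suc 0) + 8 * e 0 ^ 3 * (e (Suc 0) + 1)"])
    show "linspace (\<lambda>e. pstep (e (Suc (Suc 0))) (e 0) (e (Suc 0)))"
      unfolding pstep_def by (intro linspace_intros halves)
  qed (intro linspace_intros poly_bounded_intros poly_bounded_power le | assumption)+
  moreover have "prep (e 0) (e (Suc 0)) =
      (if e 0 = 0 then 1 + 6 * e (Suc 0) else rec_nat (e (Suc 0)) (pstep (e 0)) (e 0))" for e
    using prep_conv_rec[of "e 0" "e 0" "e (Suc 0)"] by (auto simp: prep_0)
  ultimately have "linspace (\<lambda>e. prep (e 0) (e (Suc 0)))"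
    by (simp only:) (intro linspace_intros)
  then show ?thesis using assms by (rule linspace_comp2)
qed

section \<open>Reading numbers back from words\<close>

fun bval :: "nat \<Rightarrow> sigma list \<Rightarrow> nat" where
  "bval a [] = a"
| "bval a (x # w) = bval (2 * a + (if x = D1 then 1 else 0)) w"

lemma bval_append: "bval a (u @ v) = bval (bval a u) v"
  by (induction u arbitrary: a) auto

lemma bval_code_nat: "bval 0 (code_nat n) = n"
proof (induction n rule: less_induct)
  case (less n)
  show ?case
  proof (cases "n \<le> 1")
    case True
    then show ?thesis by (auto simp: le_Suc_eq code_nat_0 code_nat_1)
  next
    case False
    then have "bval 0 (code_nat (n div 2)) = n div 2" by (intro less) auto
    with False show ?thesis by (simp add: code_nat_step bval_append odd_two_times_div_two_succ)
  qed
qed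

lemma code_nat_digits: "set (code_nat n) \<subseteq> {D0, D1}"
proof (induction n rule: less_induct)
  case (less n)
  show ?case
  proof (cases "n \<le> 1")
    case False
    then have "set (code_nat (n div 2)) \<subseteq> {D0, D1}" by (intro less) auto
    with False show ?thesis by (auto simp: code_nat_step)
  qed (auto simp: le_Suc_eq code_nat_0 code_nat_1)
qed

lemma length_code_nat: "n < 2 ^ length (code_nat n)"
proof (induction n rule: less_induct)
  case (less n)
  show ?case
  proof (cases "n \<le> 1")
    case False
    then have "n div 2 < 2 ^ length (code_nat (n div 2))" by (intro less) auto
    with False show ?thesis by (auto simp: code_nat_step)
  qed (auto simp: le_Suc_eq code_nat_0 code_nat_1)
qed

lemma code_nat_inject: "code_nat a = code_nat b \<longleftrightarrow> a = b"
  by (metis bval_code_nat)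

text \<open>The letter after the code is not a bit, so the code is the longest prefix consisting of
  bits.\<close>

lemma code_nat_append_inject:
  assumes "x \<notin> {D0, D1}" "x' \<notin> {D0, D1}"
  shows "code_nat c @ x # w = code_nat c' @ x' # w' \<longleftrightarrow> c = c' \<and> x = x' \<and> w = w'"
proof
  assume eq: "code_nat c @ x # w = code_nat c' @ x' # w'"
  have tw: "takeWhile (\<lambda>y. y \<in> {D0, D1}) (code_nat c @ x # w) = code_nat c"
    if "x \<notin> {D0, D1}" for c x w
    using that code_nat_digits[of c] by (subst takeWhile_append2) auto
  have "code_nat c = code_nat c'" using tw[OF assms(1), of c w] tw[OF assms(2), of c' w'] eq by simp
  with eq show "c = c' \<and> x = x' \<and> w = w'" by (simp add: code_nat_inject)
qed auto

lemma wnum_append_ge: "wnum w \<le> wnum (u @ w)"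
  by (induction u) auto

lemma wnum_append_ge_left: "wnum u \<le> wnum (u @ w)"
  by (induction u) auto

text \<open>A search bounded by the value of the code therefore finds the coded number.\<close>

lemma le_wnum_code_nat: "c \<le> wnum (code_nat c)"
  using wnum_ge[of "code_nat c"] length_code_nat[of c] by linarith

text \<open>The word of \<open>x\<close> is the code of \<open>c\<close>, a separator and the word
  of \<open>y\<close>. The closing parenthesis counts as a separator, so that the last number is
  read like the others.\<close>

definition scan :: "nat \<Rightarrow> nat \<Rightarrow> nat \<Rightarrow> bool" where
  "scan x c y \<longleftrightarrow> x = prep c (digit Semi + 6 * y) \<or> x = prep c (digit RPar + 6 * y)"

text \<open>At most one pair \<open>c\<close>, \<open>y\<close> satisfies \<open>scan x c y\<close>,
  so the maximum is the only hit; without a hit the result is 0.\<close>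

definition scan_num :: "nat \<Rightarrow> nat" where
  "scan_num x = bmax (\<lambda>c. \<exists>y\<le>x. scan x c y) x"

definition scan_rest :: "nat \<Rightarrow> nat" where
  "scan_rest x = bmax (\<lambda>y. \<exists>c\<le>x. scan x c y) x"

lemma scan_conv: "scan x c y \<longleftrightarrow> (\<exists>z\<in>{Semi, RPar}. nword x = code_nat c @ z # nword y)"
proof -
  have "x = wnum w \<longleftrightarrow> nword x = w" for w by auto
  then show ?thesis unfolding scan_def prep_def nword_digit by blast
qed

lemma scan_le: "scan x c y \<Longrightarrow> c \<le> x \<and> y \<le> x"
proof -
  assume "scan x c y"
  then obtain z where z: "nword x = code_nat c @ z # nword y" unfolding scan_conv by blast
  have "x = wnum (code_nat c @ z # nword y)" using z by (metis wnum_nword)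
  then show ?thesis
    using wnum_append_ge_left[of "code_nat c" "z # nword y"] le_wnum_code_nat[of c]
      wnum_append_ge[of "nword y" "code_nat c @ [z]"] by auto
qed

lemma scan_unique:
  assumes "scan x c y" "scan x c' y'"
  shows "c' = c \<and> y' = y"
proof -
  obtain z z' where z: "z \<in> {Semi, RPar}" "z' \<in> {Semi, RPar}"
    and "code_nat c @ z # nword y = code_nat c' @ z' # nword y'"
    using assms unfolding scan_conv by metis
  moreover have "z \<notin> {D0, D1}" "z' \<notin> {D0, D1}" using z by auto
  ultimately have "c = c' \<and> z = z' \<and> nword y = nword y'" using code_nat_append_inject by blast
  then show ?thesis by (metis wnum_nword)
qed

lemma scan_correct:
  assumes "z = Semi \<or> z = RPar"
  shows "scan_num (wnum (code_nat c @ z # w)) = c" "scan_rest (wnum (code_nat c @ z # w)) = wnum w"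
proof -
  let ?x = "wnum (code_nat c @ z # w)"
  have s: "scan ?x c (wnum w)" using assms unfolding scan_conv by auto
  note le = scan_le[OF s]
  have u: "b = c \<and> y = wnum w" if "scan ?x b y" for b y using scan_unique[OF s that] .
  show "scan_num ?x = c" unfolding scan_num_def
    using s le u by (intro bmax_eqI) blast+
  show "scan_rest ?x = wnum w" unfolding scan_rest_def
    using s le u by (intro bmax_eqI) blast+
qed

lemma linspace_pred_scan [linspace_intros]:
  "linspace f \<Longrightarrow> linspace g \<Longrightarrow> linspace h \<Longrightarrow> linspace_pred (\<lambda>e. scan (f e) (g e) (h e))"
  unfolding scan_def by (intro linspace_intros)

lemma linspace_scan_num [linspace_intros]:
  "linspace f \<Longrightarrow> linspace (\<lambda>e. scan_num (f e))"
  by (rule linspace_comp1[where H = scan_num]) (unfold scan_num_def, intro linspace_intros)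

lemma linspace_scan_rest [linspace_intros]:
  "linspace f \<Longrightarrow> linspace (\<lambda>e. scan_rest (f e))"
  by (rule linspace_comp1[where H = scan_rest]) (unfold scan_rest_def, intro linspace_intros)

definition num_of_code :: "nat \<Rightarrow> nat" where
  "num_of_code x = bmax (\<lambda>n. prep n 0 = x) x"

lemma prep_Nil: "prep n 0 = wnum (code_nat n)"
  by (simp add: prep_def)

lemma num_of_code: "num_of_code (wnum (code_nat n)) = n"
  unfolding num_of_code_def prep_Nil
  by (rule bmax_eqI) (auto simp: wnum_inject code_nat_inject le_wnum_code_nat)

lemma linspace_num_of_code [linspace_intros]:
  "linspace f \<Longrightarrow> linspace (\<lambda>e. num_of_code (f e))"
  by (rule linspace_comp1[where H = num_of_code]) (unfold num_of_code_def, intro linspace_intros)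

section \<open>Sums of powers of omega\<close>

abbreviation osum :: "(nat \<times> nat) list \<Rightarrow> cord" where
  "osum pcs \<equiv> (\<Sum>(p, c)\<leftarrow>pcs. omega_term p c)"

text \<open>The conditions of \<open>is_nf\<close> without nonemptiness, so that \<open>[]\<close>
  represents 0.\<close>

definition normal :: "(nat \<times> nat) list \<Rightarrow> bool" where
  "normal pcs \<longleftrightarrow> (\<forall>(p, c)\<in>set pcs. c \<ge> 1) \<and> successively (\<lambda>(p, _) (q, _). p \<noteq> q) pcs"

lemma omega_term_add: "omega_term p (a + b) = omega_term p a + omega_term p b"
  by (induction b) (auto simp: omega_term_Suc add.assoc[symmetric])

lemma L_hier_add: "L_hier (\<alpha> + \<beta>) n = L_hier \<alpha> n + L_hier \<beta> n"
  by (induction \<beta>) auto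

lemma G_hier_add: "G_hier (\<alpha> + \<beta>) n = G_hier \<alpha> n + G_hier \<beta> n"
  by (induction \<beta>) auto

lemma L_hier_0 [simp]: "L_hier 0 n = 0" and G_hier_0 [simp]: "G_hier 0 n = 0"
  by (simp_all add: zero_cord_def)

text \<open>The length of the \<open>p\<close>-th power of omega: one step from the limit to its
  element with index \<open>n\<close>, then \<open>n + 1\<close> copies of the next lower
  power.\<close>

primrec ell :: "nat \<Rightarrow> nat \<Rightarrow> nat" where
  "ell n 0 = 1"
| "ell n (Suc p) = 1 + (n + 1) * ell n p"

lemma L_hier_omega_term_opow: "L_hier (omega_term p c) n = c * L_hier (opow omega (ofin p)) n"
  by (induction c) (auto simp: omega_term_Suc L_hier_add)

lemma L_hier_opow: "L_hier (opow omega (ofin p)) n = ell n p"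
proof (induction p)
  case (Suc p)
  then show ?case unfolding opow_omega_Suc by (simp add: L_hier_omega_term_opow)
qed simp

lemma L_hier_omega_term: "L_hier (omega_term p c) n = c * ell n p"
  by (simp add: L_hier_omega_term_opow L_hier_opow)

lemma G_hier_omega_term_opow: "G_hier (omega_term p c) n = c * G_hier (opow omega (ofin p)) n"
  by (induction c) (auto simp: omega_term_Suc G_hier_add)

lemma G_hier_omega_term: "G_hier (omega_term p c) n = c * (n + 1) ^ p"
proof -
  have "G_hier (opow omega (ofin p)) n = (n + 1) ^ p"
  proof (induction p)
    case (Suc p)
    then show ?case unfolding opow_omega_Suc by (simp add: G_hier_omega_term_opow)
  qed simp
  then show ?thesis by (simp add: G_hier_omega_term_opow)
qed

lemma L_hier_osum: "L_hier (osum pcs) n = (\<Sum>(p, c)\<leftarrow>pcs. c * ell n p)"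
  by (induction pcs) (auto simp: L_hier_add L_hier_omega_term)

lemma G_hier_osum: "G_hier (osum pcs) n = (\<Sum>(p, c)\<leftarrow>pcs. c * (n + 1) ^ p)"
  by (induction pcs) (auto simp: G_hier_add G_hier_omega_term)

section \<open>The descent from an ordinal\<close>

lemma L_hier_opred: "L_hier (opred \<alpha> n) n = L_hier \<alpha> n - 1"
  by (cases \<alpha>) auto

lemma Rb_Suc: "Rb (Suc i) \<alpha> n = Rb i (opred \<alpha> n) n"
  by (induction i) auto

lemma R_hier_ge: "L_hier \<alpha> n \<le> i \<Longrightarrow> R_hier i \<alpha> n = \<alpha>"
  by (simp add: R_hier_def)

text \<open>\<open>R_hier\<close> indexes the descent by the length to be reached, and this target
  is unaffected by carrying out the first step.\<close>

lemma R_hier_less: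
  assumes "i < L_hier \<alpha> n"
  shows "R_hier i \<alpha> n = R_hier i (opred \<alpha> n) n"
proof -
  have "L_hier \<alpha> n - i = Suc (L_hier (opred \<alpha> n) n - i)"
    using assms by (simp add: L_hier_opred)
  then show ?thesis by (simp only: R_hier_def Rb_Suc)
qed

lemma R_hier_0 [simp]: "R_hier i 0 n = 0"
  by (simp add: R_hier_ge)

text \<open>Predecessors of \<open>\<gamma> + \<beta>\<close> act on \<open>\<beta>\<close> until it
  is used up, so the left summand survives when the target is at least its length.\<close>

lemma R_hier_add_ge:
  "L_hier \<gamma> n \<le> i \<Longrightarrow> R_hier i (\<gamma> + \<beta>) n = \<gamma> + R_hier (i - L_hier \<gamma> n) \<beta> n"
proof (induction \<beta>)
  case OZero
  then show ?case by (simp add: R_hier_ge)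
next
  case (OSucc \<beta>)
  then show ?case
    by (cases "L_hier (\<gamma> + OSucc \<beta>) n \<le> i") (simp_all add: R_hier_ge R_hier_less L_hier_add)
next
  case (OLim b)
  then show ?case
    by (cases "L_hier (\<gamma> + OLim b) n \<le> i") (simp_all add: R_hier_ge R_hier_less L_hier_add)
qed

text \<open>The descent from the sum passes through \<open>\<gamma>\<close>.\<close>

lemma R_hier_add_less: "i < L_hier \<gamma> n \<Longrightarrow> R_hier i (\<gamma> + \<beta>) n = R_hier i \<gamma> n"
  by (induction \<beta>) (auto simp: R_hier_less L_hier_add)

text \<open>Greedy expansion of \<open>i\<close> in the lengths of the powers of omega; at exponent
  0 the length is 1, so the whole remainder becomes the coefficient. The coefficient of the starting
  term does not enter.\<close>

primrec desc :: "nat \<Rightarrow> nat \<Rightarrow> nat \<Rightarrow> (nat \<times> nat) list" where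
  "desc n 0 i = [(0, i)]"
| "desc n (Suc p) i = (Suc p, i div ell n (Suc p)) # desc n p (i mod ell n (Suc p))"

lemma ell_pos: "0 < ell n p"
  by (cases p) auto

text \<open>After \<open>d\<close> whole copies the target \<open>r\<close> lies strictly inside the
  next copy. The first step there leads to \<open>omega_term p (Suc n)\<close>, whose length
  \<open>ell n (Suc p) - 1\<close> is still at least \<open>r\<close>, so the induction hypothesis
  applies with coefficient \<open>Suc n\<close>.\<close>

lemma R_hier_omega_term: "i \<le> c * ell n p \<Longrightarrow> R_hier i (omega_term p c) n = osum (desc n p i)"
proof (induction p arbitrary: c i)
  case 0
  then have c: "c = i + (c - i)" by simp
  have "R_hier i (omega_term 0 i + omega_term 0 (c - i)) n = omega_term 0 i + R_hier 0 (omega_term 0 (c - i)) n"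
    by (subst R_hier_add_ge) (simp_all add: L_hier_omega_term)
  moreover have "R_hier 0 (omega_term 0 a) n = 0" for a
  proof (induction a)
    case (Suc a)
    have "R_hier 0 (omega_term 0 (Suc a)) n = R_hier 0 (opred (omega_term 0 (Suc a)) n) n"
      by (rule R_hier_less) (simp add: L_hier_omega_term)
    also have "opred (omega_term 0 (Suc a)) n = omega_term 0 a"
      by (simp add: omega_term_Suc)
    finally show ?case using Suc by simp
  qed simp
  ultimately show ?case using c by (metis (no_types) desc.simps(1) add.right_neutral list.map(1,2)
        case_prod_conv omega_term_add sum_list.Cons sum_list.Nil)
next
  case (Suc p)
  define d where "d = i div ell n (Suc p)"
  define r where "r = i mod ell n (Suc p)"
  have i: "i = d * ell n (Suc p) + r" unfolding d_def r_def by (rule div_mult_mod_eq[symmetric])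
  have r: "r < ell n (Suc p)" using ell_pos[of n "Suc p"] by (simp add: r_def del: ell.simps)
  have "d \<le> c"
    using Suc.prems ell_pos[of n "Suc p"] div_le_mono[of i "c * ell n (Suc p)" "ell n (Suc p)"]
    by (simp add: d_def del: ell.simps)
  then have c: "omega_term (Suc p) c = omega_term (Suc p) d + omega_term (Suc p) (c - d)"
    by (simp flip: omega_term_add)
  have 1: "R_hier i (omega_term (Suc p) c) n =
      omega_term (Suc p) d + R_hier r (omega_term (Suc p) (c - d)) n"
    unfolding c by (subst R_hier_add_ge) (simp_all add: L_hier_omega_term i del: ell.simps)
  have "R_hier r (omega_term (Suc p) (c - d)) n = osum (desc n p r)"
  proof (cases "c - d")
    case 0
    \<comment> \<open>No copy is left, so \<open>d = c\<close>, and
      \<open>i \<le> c * ell n (Suc p)\<close> leaves no remainder.\<close>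
    then have "r = 0" using Suc.prems i \<open>d \<le> c\<close> by (simp del: ell.simps)
    moreover have "osum (desc n p 0) = 0" for p by (induction p) auto
    ultimately show ?thesis using 0 by simp
  next
    case (Suc a)
    have "omega_term (Suc p) (Suc a) = opow omega (ofin (Suc p)) + omega_term (Suc p) a"
      using omega_term_add[of "Suc p" 1 a] by (simp add: omega_term_1 del: ofin.simps)
    then have "R_hier r (omega_term (Suc p) (Suc a)) n = R_hier r (opow omega (ofin (Suc p))) n"
      using r by (simp add: R_hier_add_less L_hier_opow del: ell.simps ofin.simps)
    also have "\<dots> = R_hier r (opred (opow omega (ofin (Suc p))) n) n"
      using r by (intro R_hier_less) (simp add: L_hier_opow del: ell.simps ofin.simps)
    also have "opred (opow omega (ofin (Suc p))) n = omega_term p (Suc n)"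
      unfolding opow_omega_Suc by simp
    also have "R_hier r (omega_term p (Suc n)) n = osum (desc n p r)"
      using r by (intro Suc.IH) simp
    finally show ?thesis by (simp add: Suc)
  qed
  with 1 show ?case by (simp add: d_def r_def del: ell.simps)
qed

text \<open>\<open>R_hier_add_ge\<close> justifies the first branch, \<open>R_hier_add_less\<close>
  the loss of all later summands in the second. The result need not be normal: it may contain zero
  coefficients, and dropping these can bring equal exponents together.\<close>

fun rlist :: "nat \<Rightarrow> nat \<Rightarrow> (nat \<times> nat) list \<Rightarrow> (nat \<times> nat) list" where
  "rlist n i [] = []"
| "rlist n i ((p, c) # pcs) =
    (if c * ell n p \<le> i then (p, c) # rlist n (i - c * ell n p) pcs else desc n p i)"

lemma R_hier_osum: "R_hier i (osum pcs) n = osum (rlist n i pcs)"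
proof (induction pcs arbitrary: i)
  case (Cons pc pcs)
  obtain p c where "pc = (p, c)" by fastforce
  with Cons show ?case
    by (auto simp: R_hier_add_ge R_hier_add_less L_hier_omega_term R_hier_omega_term)
qed simp

section \<open>Codes of ordinals\<close>

text \<open>The code without its opening parenthesis. Every number is then followed by a separator,
  and what remains after a pair is again of this form or empty.\<close>

fun ocode :: "(nat \<times> nat) list \<Rightarrow> sigma list" where
  "ocode [] = [RPar]"
| "ocode ((p, c) # pcs) =
    code_nat p @ Semi # code_nat c @ (if pcs = [] then [RPar] else Semi # ocode pcs)"

lemma join_semi_ocode:
  "join_semi (concat (map (\<lambda>(p, c). [code_nat p, code_nat c]) pcs)) @ [RPar] = ocode pcs"
proof (induction pcs)
  case (Cons pc pcs)
  obtain p c where "pc = (p, c)" by fastforce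
  with Cons show ?case by (cases pcs) auto
qed simp

lemma osum_eq_0:
  assumes "normal pcs"
  shows "osum pcs = 0 \<longleftrightarrow> pcs = []"
proof
  assume "osum pcs = 0"
  then have "concat (map (\<lambda>(p, c). replicate c p) pcs) = []"
    unfolding sum_omega_term_conv by (intro sum_opow_omega_inject) simp
  then show "pcs = []" using assms by (cases pcs) (auto simp: normal_def)
qed simp

lemma code_ord_osum:
  assumes "normal pcs"
  shows "code_ord (osum pcs) = LPar # ocode pcs"
proof (cases "pcs = []")
  case True
  then show ?thesis by (simp add: code_ord_def)
next
  case False
  then have "is_nf (osum pcs) pcs" using assms by (simp add: is_nf_def normal_def)
  then have "nf (osum pcs) = pcs" unfolding nf_def using nf_unique by blast
  then show ?thesis using False osum_eq_0[OF assms] join_semi_ocode[of pcs] by (simp add: code_ord_def)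
qed

lemma ocode_inject: "ocode xs = ocode ys \<Longrightarrow> xs = ys"
proof (induction xs arbitrary: ys)
  case Nil
  show ?case
  proof (cases ys)
    case (Cons y ys')
    obtain p c where "y = (p, c)" by fastforce
    with Cons Nil code_nat_digits[of p] show ?thesis by (cases "code_nat p") auto
  qed simp
next
  case (Cons x xs)
  obtain p c where x: "x = (p, c)" by fastforce
  show ?case
  proof (cases ys)
    case Nil
    with Cons.prems x code_nat_digits[of p] show ?thesis by (cases "code_nat p") auto
  next
    case ys: (Cons y ys')
    obtain q d where y: "y = (q, d)" by fastforce
    show ?thesis
      using Cons.prems Cons.IH[of ys'] unfolding x y ys
      by (cases "xs = []"; cases "ys' = []") (auto simp: code_nat_append_inject code_nat_inject)
  qed
qed

text \<open>The exponents occurring in \<open>Psi k m\<close> are from a finite set of lists, so that a machine can treat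
  every list separately; only the coefficients vary.\<close>

definition shapes :: "nat \<Rightarrow> nat \<Rightarrow> nat list set" where
  "shapes k m = {ps. set ps \<subseteq> {..<k} \<and> sorted_wrt (>) (drop m ps)}"

lemma finite_shapes: "finite (shapes k m)"
proof (rule finite_subset)
  show "shapes k m \<subseteq> {ps. set ps \<subseteq> {..<k} \<and> length ps \<le> m + k}"
  proof
    fix ps assume ps: "ps \<in> shapes k m"
    then have "sorted_wrt (>) (drop m ps)" by (simp add: shapes_def)
    moreover have "sorted_wrt (>) xs \<Longrightarrow> distinct xs" for xs :: "nat list" by (induction xs) auto
    ultimately have "distinct (drop m ps)" by blast
    moreover have "set (drop m ps) \<subseteq> {..<k}" using ps set_drop_subset[of m ps] by (auto simp: shapes_def)
    ultimately have "length (drop m ps) \<le> k"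
      using card_mono[of "{..<k}" "set (drop m ps)"] by (simp add: distinct_card)
    then show "ps \<in> {ps. set ps \<subseteq> {..<k} \<and> length ps \<le> m + k}" using ps by (simp add: shapes_def)
  qed
  show "finite {ps. set ps \<subseteq> {..<k} \<and> length ps \<le> m + k}" by (rule finite_lists_length_le) simp
qed

text \<open>Turns a defining sum of \<open>Psi\<close>, with its zero coefficients and repeated
  exponents, into a normal form.\<close>

fun merge :: "(nat \<times> nat) list \<Rightarrow> (nat \<times> nat) list" where
  "merge [] = []"
| "merge ((p, c) # pcs) =
    (if c = 0 then merge pcs
     else case merge pcs of
       [] \<Rightarrow> [(p, c)]
     | (q, d) # qds \<Rightarrow> if p = q then (p, c + d) # qds else (p, c) # (q, d) # qds)"

lemma normal_merge: "normal (merge pcs)"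
  by (induction pcs rule: merge.induct) (auto simp: normal_def successively_Cons split: list.splits prod.splits)

lemma osum_merge: "osum (merge pcs) = osum pcs"
  by (induction pcs rule: merge.induct)
    (auto simp: omega_term_add add.assoc split: list.splits prod.splits)

lemma set_merge: "fst ` set (merge pcs) \<subseteq> fst ` set pcs"
proof (induction pcs rule: merge.induct)
  case (2 p c pcs)
  then show ?case by (cases "c = 0"; cases "merge pcs") auto
qed simp

text \<open>Dropping and merging only move entries to the left, so the exponents after the first
  \<open>m\<close> positions form a sublist of the original ones there.\<close>

lemma merge_shape: "sorted_wrt (>) (drop m (map fst pcs)) \<Longrightarrow> sorted_wrt (>) (drop m (map fst (merge pcs)))"
proof (induction pcs arbitrary: m)
  case (Cons pc pcs)
  obtain p c where pc: "pc = (p, c)" by fastforce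
  show ?case
  proof (cases m)
    case 0
    then have "sorted_wrt (>) (map fst (merge pcs))" "\<forall>q\<in>fst ` set pcs. q < p"
      using Cons.prems Cons.IH[of 0] by (auto simp: pc)
    then show ?thesis using 0 set_merge[of pcs]
      by (cases "merge pcs") (fastforce simp: pc)+
  next
    case (Suc m')
    then have IH: "sorted_wrt (>) (drop m' (map fst (merge pcs)))" using Cons by simp
    \<comment> \<open>Needed when the head vanishes or is absorbed by its neighbour;
      \<open>IH\<close> serves when it stays.\<close>
    then have IH': "sorted_wrt (>) (drop (Suc m') (map fst (merge pcs)))"
      using sorted_wrt_drop[of "(>)" "drop m' (map fst (merge pcs))" 1] by simp
    show ?thesis
      using IH IH' Suc by (cases "merge pcs") (auto simp: pc)
  qed
qed simp

text \<open>Exponents missing from the list enter with coefficient 0.\<close>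

lemma osum_decreasing:
  "sorted_wrt (>) (map fst pcs) \<Longrightarrow> fst ` set pcs \<subseteq> {..<k} \<Longrightarrow>
    \<exists>d. osum pcs = (\<Sum>j\<leftarrow>[0..<k]. omega_term (k - 1 - j) (d j))"
proof (induction k arbitrary: pcs)
  case 0
  then show ?case by simp
next
  case (Suc k)
  have upt: "[0..<Suc k] = 0 # map Suc [0..<k]" by (simp add: upt_conv_Cons map_Suc_upt del: upt_Suc)
  have shift: "(\<Sum>j\<leftarrow>[0..<Suc k]. omega_term (Suc k - 1 - j) (case_nat c d j)) =
      omega_term k c + (\<Sum>j\<leftarrow>[0..<k]. omega_term (k - 1 - j) (d j))" for c d
    unfolding upt by (simp add: o_def del: upt_Suc)
  show ?case
  proof (cases "\<exists>c pcs'. pcs = (k, c) # pcs'")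
    case True
    then obtain c pcs' where pcs: "pcs = (k, c) # pcs'" by blast
    have "fst ` set pcs' \<subseteq> {..<k}" "sorted_wrt (>) (map fst pcs')" using Suc.prems by (auto simp: pcs)
    then obtain d where "osum pcs' = (\<Sum>j\<leftarrow>[0..<k]. omega_term (k - 1 - j) (d j))" using Suc.IH by blast
    then show ?thesis using shift[of c d] by (intro exI[of _ "case_nat c d"]) (simp add: pcs del: upt_Suc)
  next
    case False
    have "fst ` set pcs \<subseteq> {..<k}"
    proof (cases pcs)
      case (Cons pc pcs')
      moreover from this have "fst pc < k" using False Suc.prems by (cases pc) (auto simp: less_Suc_eq)
      ultimately show ?thesis using Suc.prems by auto
    qed simp
    then obtain d where "osum pcs = (\<Sum>j\<leftarrow>[0..<k]. omega_term (k - 1 - j) (d j))"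
      using Suc by blast
    then show ?thesis using shift[of 0 d] by (intro exI[of _ "case_nat 0 d"]) (simp del: upt_Suc)
  qed
qed

text \<open>The \<open>m\<close> unrestricted summands correspond to the first \<open>m\<close>
  entries, the decreasing block to the rest.\<close>

lemma Psi_iff:
  assumes "1 \<le> k"
  shows "\<alpha> \<in> Psi k m \<longleftrightarrow> (\<exists>pcs. normal pcs \<and> map fst pcs \<in> shapes k m \<and> \<alpha> = osum pcs)"
proof
  assume "\<alpha> \<in> Psi k m"
  then consider "\<alpha> = 0"
    | p c d where "\<forall>i\<in>{1..m}. p i < k"
      "\<alpha> = (\<Sum>i\<leftarrow>[1..<m+1]. omega_term (p i) (c i)) + (\<Sum>j\<leftarrow>[0..<k]. omega_term (k - 1 - j) (d j))"
    unfolding Psi_def by blast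
  then show "\<exists>pcs. normal pcs \<and> map fst pcs \<in> shapes k m \<and> \<alpha> = osum pcs"
  proof cases
    case 1
    then show ?thesis by (intro exI[of _ "[]"]) (simp add: normal_def shapes_def)
  next
    case (2 p c d)
    define qs where "qs = map (\<lambda>i. (p i, c i)) [1..<m+1] @ map (\<lambda>j. (k - 1 - j, d j)) [0..<k]"
    have "sorted_wrt (>) (map (\<lambda>j. k - 1 - j) [0..<k])"
      by (auto simp: sorted_wrt_iff_nth_less)
    then have "sorted_wrt (>) (drop m (map fst qs))" by (simp add: qs_def o_def del: upt_Suc)
    moreover have "fst ` set qs \<subseteq> {..<k}" using 2 assms by (auto simp: qs_def simp del: upt_Suc)
    ultimately have "map fst (merge qs) \<in> shapes k m"
      using merge_shape[of m qs] set_merge[of qs] by (auto simp: shapes_def)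
    moreover have "\<alpha> = osum (merge qs)"
      using 2 by (simp add: osum_merge qs_def o_def del: upt_Suc)
    ultimately show ?thesis using normal_merge by blast
  qed
next
  assume "\<exists>pcs. normal pcs \<and> map fst pcs \<in> shapes k m \<and> \<alpha> = osum pcs"
  then obtain pcs where pcs: "map fst pcs \<in> shapes k m" "\<alpha> = osum pcs" by blast
  \<comment> \<open>Short lists are padded with \<open>omega_term 0 0\<close>, whose exponent is
    below \<open>k\<close> because \<open>1 \<le> k\<close>.\<close>
  define xs where "xs = take m pcs @ replicate (m - length pcs) (0, 0)"
  have len: "length xs = m" by (simp add: xs_def)
  have xs: "osum xs = osum (take m pcs)" 
  proof -
    have "sum_list (replicate n (0 :: cord)) = 0" for n by (induction n) auto
    then show ?thesis by (simp add: xs_def map_replicate_const)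
  qed
  have k: "fst ` set xs \<subseteq> {..<k}"
    using pcs assms set_take_subset[of m pcs] by (auto simp: xs_def shapes_def)
  have "fst ` set (drop m pcs) \<subseteq> {..<k}" "sorted_wrt (>) (map fst (drop m pcs))"
    using pcs set_drop_subset[of m pcs] by (auto simp: shapes_def drop_map)
  then obtain d where d: "osum (drop m pcs) = (\<Sum>j\<leftarrow>[0..<k]. omega_term (k - 1 - j) (d j))"
    using osum_decreasing by blast
  define p where "p i = fst (xs ! (i - 1))" for i
  define c where "c i = snd (xs ! (i - 1))" for i
  have "(\<Sum>i\<leftarrow>[1..<m+1]. omega_term (p i) (c i)) = osum xs"
  proof -
    have "[1..<m+1] = map Suc [0..<m]" by (simp add: map_Suc_upt del: upt_Suc)
    then have "map (\<lambda>i. omega_term (p i) (c i)) [1..<m+1] = map (\<lambda>(p, c). omega_term p c) xs"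
      by (intro nth_equalityI) (auto simp: len p_def c_def split_def simp del: upt_Suc)
    then show ?thesis by simp
  qed
  moreover have "\<alpha> = osum (take m pcs) + osum (drop m pcs)"
    unfolding pcs(2) by (metis append_take_drop_id map_append sum_list_append)
  ultimately have "\<alpha> = (\<Sum>i\<leftarrow>[1..<m+1]. omega_term (p i) (c i)) + (\<Sum>j\<leftarrow>[0..<k]. omega_term (k - 1 - j) (d j))"
    using d xs by simp
  moreover have "\<forall>i\<in>{1..m}. p i < k"
    using k len by (auto simp: p_def subset_iff)
  ultimately show "\<alpha> \<in> Psi k m" unfolding Psi_def by blast
qed

section \<open>Linear space on coded ordinals\<close>

text \<open>Exponents are constants of the program, coefficients are functions of the
  inputs.\<close>

definition ev :: "(nat \<times> ((nat \<Rightarrow> nat) \<Rightarrow> nat)) list \<Rightarrow> (nat \<Rightarrow> nat) \<Rightarrow> (nat \<times> nat) list" where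
  "ev pfs e = map (\<lambda>(p, f). (p, f e)) pfs"

lemma ev_simps [simp]:
  "ev [] e = []" "ev ((p, f) # pfs) e = (p, f e) # ev pfs e" "ev (pfs @ qfs) e = ev pfs e @ ev qfs e"
  by (simp_all add: ev_def)

text \<open>Linear space under a promise, for case distinctions in which \<open>f\<close> has a
  simple form on \<open>P\<close> only.\<close>

definition linspace_on :: "((nat \<Rightarrow> nat) \<Rightarrow> bool) \<Rightarrow> ((nat \<Rightarrow> nat) \<Rightarrow> nat) \<Rightarrow> bool" where
  "linspace_on P f \<longleftrightarrow> (\<exists>g. linspace g \<and> (\<forall>e. P e \<longrightarrow> f e = g e))"

lemma linspace_on_split:
  assumes "linspace_pred Q" "linspace_on (\<lambda>e. P e \<and> Q e) f" "linspace_on (\<lambda>e. P e \<and> \<not> Q e) f"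
  shows "linspace_on P f"
proof -
  obtain g h where "linspace g" "\<forall>e. P e \<and> Q e \<longrightarrow> f e = g e" "linspace h" "\<forall>e. P e \<and> \<not> Q e \<longrightarrow> f e = h e"
    using assms unfolding linspace_on_def by blast
  then show ?thesis unfolding linspace_on_def
    using assms(1) by (intro exI[of _ "\<lambda>e. if Q e then g e else h e"]) (auto intro: linspace_intros)
qed

lemma wnum_code_nat_append: "wnum (code_nat c @ w) = prep c (wnum w)"
  by (simp add: prep_def)

lemma linspace_ocode:
  "\<forall>(p, f)\<in>set pfs. linspace f \<Longrightarrow> linspace (\<lambda>e. wnum (ocode (ev pfs e)))"
proof (induction pfs)
  case Nil
  then show ?case by (simp add: linspace_const)
next
  case (Cons pf pfs)
  obtain p f where pf: "pf = (p, f)" by fastforce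
  have "ev pfs e = [] \<longleftrightarrow> pfs = []" for e by (simp add: ev_def)
  with Cons show ?case
    by (cases "pfs = []") (auto simp: pf wnum_code_nat_append intro!: linspace_intros simp del: add_Suc)
qed

text \<open>Normalisation when the zero coefficients depend on the input. \<open>A\<close> is the
  part already normal under \<open>P\<close>. The next coefficient is dropped if it vanishes;
  otherwise it is added to an equal last exponent of \<open>A\<close> or appended, and which of the
  two is known in advance. Each case strengthens \<open>P\<close>.\<close>

lemma linspace_code_osum_aux:
  assumes "\<forall>(p, f)\<in>set (A @ B). linspace f" "\<And>e. P e \<Longrightarrow> normal (ev A e)"
  shows "linspace_on P (\<lambda>e. wnum (code_ord (osum (ev (A @ B) e))))"
  using assms
proof (induction B arbitrary: A P)
  case Nil
  then have "linspace (\<lambda>e. 3 + 6 * wnum (ocode (ev A e)))"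
    by (intro linspace_intros linspace_ocode) simp
  with Nil show ?case unfolding linspace_on_def
    by (intro exI[of _ "\<lambda>e. 3 + 6 * wnum (ocode (ev A e))"]) (simp add: code_ord_osum)
next
  case (Cons pf B)
  obtain p f where pf: "pf = (p, f)" by fastforce
  show ?case
  proof (rule linspace_on_split[where Q = "\<lambda>e. f e = 0"])
    show "linspace_pred (\<lambda>e. f e = 0)" using Cons.prems by (auto simp: pf intro: linspace_intros)
    have "linspace_on (\<lambda>e. P e \<and> f e = 0) (\<lambda>e. wnum (code_ord (osum (ev (A @ B) e))))"
      using Cons.prems by (intro Cons.IH) auto
    then show "linspace_on (\<lambda>e. P e \<and> f e = 0) (\<lambda>e. wnum (code_ord (osum (ev (A @ pf # B) e))))"
      unfolding linspace_on_def by (auto simp: pf)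
    show "linspace_on (\<lambda>e. P e \<and> f e \<noteq> 0) (\<lambda>e. wnum (code_ord (osum (ev (A @ pf # B) e))))"
    proof (cases "\<exists>A' g. A = A' @ [(p, g)]")
      case True
      then obtain A' g where A: "A = A' @ [(p, g)]" by blast
      have "normal (ev (A' @ [(p, \<lambda>e. g e + f e)]) e)" if "P e" for e
        using Cons.prems(2)[OF that] by (auto simp: normal_def A successively_append_iff)
      then have "linspace_on (\<lambda>e. P e \<and> f e \<noteq> 0)
          (\<lambda>e. wnum (code_ord (osum (ev ((A' @ [(p, \<lambda>e. g e + f e)]) @ B) e))))"
        using Cons.prems(1) by (intro Cons.IH) (auto simp: A pf intro: linspace_intros)
      then show ?thesis by (simp add: A pf omega_term_add add.assoc)
    next
      case False
      have "normal (ev (A @ [(p, f)]) e)" if "P e \<and> f e \<noteq> 0" for e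
        using Cons.prems(2)[of e] that False
        by (cases A rule: rev_cases) (auto simp: normal_def successively_append_iff)
      then have "linspace_on (\<lambda>e. P e \<and> f e \<noteq> 0)
          (\<lambda>e. wnum (code_ord (osum (ev ((A @ [(p, f)]) @ B) e))))"
        using Cons.prems(1) by (intro Cons.IH) (auto simp: pf)
      then show ?thesis by (simp add: pf)
    qed
  qed
qed

lemma linspace_code_osum:
  assumes "\<forall>(p, f)\<in>set pfs. linspace f"
  shows "linspace (\<lambda>e. wnum (code_ord (osum (ev pfs e))))"
proof -
  have "linspace_on (\<lambda>_. True) (\<lambda>e. wnum (code_ord (osum (ev ([] @ pfs) e))))"
    using assms by (intro linspace_code_osum_aux) (auto simp: normal_def)
  then obtain g where "linspace g" "\<And>e. wnum (code_ord (osum (ev pfs e))) = g e"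
    unfolding linspace_on_def by auto
  then show ?thesis by simp
qed

lemma linspace_ell [linspace_intros]: "linspace n \<Longrightarrow> linspace (\<lambda>e. ell (n e) p)"
  by (induction p) (auto intro!: linspace_intros simp del: add_Suc)

primrec descf :: "((nat \<Rightarrow> nat) \<Rightarrow> nat) \<Rightarrow> nat \<Rightarrow> ((nat \<Rightarrow> nat) \<Rightarrow> nat) \<Rightarrow> (nat \<times> ((nat \<Rightarrow> nat) \<Rightarrow> nat)) list" where
  "descf n 0 i = [(0, i)]"
| "descf n (Suc p) i =
    (Suc p, \<lambda>e. i e div ell (n e) (Suc p)) # descf n p (\<lambda>e. i e mod ell (n e) (Suc p))"

lemma ev_descf: "ev (descf n p i) e = desc (n e) p (i e)"
  by (induction p arbitrary: i) auto

lemma linspace_descf: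
  "linspace n \<Longrightarrow> linspace i \<Longrightarrow> \<forall>(p, f)\<in>set (descf n p i). linspace f"
proof (induction p arbitrary: i)
  case (Suc p)
  have "linspace (\<lambda>e. i e mod ell (n e) (Suc p))" "linspace (\<lambda>e. i e div ell (n e) (Suc p))"
    by (intro linspace_intros Suc.prems)+
  then show ?case using Suc by (simp del: ell.simps)
qed simp

text \<open>\<open>A\<close> collects the summands kept so far, and each comparison with
  \<open>i\<close> becomes a test of the program.\<close>

lemma linspace_code_rlist:
  assumes "\<forall>(p, f)\<in>set (A @ pfs). linspace f" "linspace n" "linspace i"
  shows "linspace (\<lambda>e. wnum (code_ord (osum (ev A e @ rlist (n e) (i e) (ev pfs e)))))"
  using assms
proof (induction pfs arbitrary: A i)
  case Nil
  then show ?case using linspace_code_osum[of A] by simp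
next
  case (Cons pf pfs)
  obtain p f where pf: "pf = (p, f)" by fastforce
  have f: "linspace f" using Cons.prems by (simp add: pf)
  have 1: "linspace (\<lambda>e. wnum (code_ord (osum (ev (A @ [(p, f)]) e @
      rlist (n e) (i e - f e * ell (n e) p) (ev pfs e)))))"
    using Cons.prems f by (intro Cons.IH linspace_intros) (auto simp: pf)
  have 2: "linspace (\<lambda>e. wnum (code_ord (osum (ev (A @ descf n p i) e))))"
    using Cons.prems linspace_descf[of n i p] by (intro linspace_code_osum) auto
  have 3: "linspace_pred (\<lambda>e. f e * ell (n e) p \<le> i e)" using f Cons.prems by (intro linspace_intros)
  have "wnum (code_ord (osum (ev A e @ rlist (n e) (i e) (ev (pf # pfs) e)))) =
      (if f e * ell (n e) p \<le> i e
       then wnum (code_ord (osum (ev (A @ [(p, f)]) e @ rlist (n e) (i e - f e * ell (n e) p) (ev pfs e))))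
       else wnum (code_ord (osum (ev (A @ descf n p i) e))))" for e
    by (simp add: pf ev_descf)
  then show ?case using linspace_if[OF 3 1 2] by (simp only:)
qed

lemma linspace_L_hier:
  assumes "\<forall>(p, f)\<in>set pfs. linspace f" "linspace n"
  shows "linspace (\<lambda>e. L_hier (osum (ev pfs e)) (n e))"
  unfolding L_hier_osum using assms(1)
proof (induction pfs)
  case (Cons pf pfs)
  then show ?case using assms(2) by (cases pf) (auto intro!: linspace_intros)
qed (simp add: linspace_const)

lemma linspace_G_hier:
  assumes "\<forall>(p, f)\<in>set pfs. linspace f" "linspace n"
  shows "linspace (\<lambda>e. G_hier (osum (ev pfs e)) (n e))"
  unfolding G_hier_osum using assms(1)
proof (induction pfs)
  case (Cons pf pfs)
  then show ?case using assms(2) by (cases pf) (auto intro!: linspace_intros simp del: power_Suc add_Suc_right)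
qed (simp add: linspace_const)

section \<open>Parsing codes of ordinals\<close>

text \<open>Dividing by 6 removes the opening parenthesis, whose digit 3 is below 6. Exponents and
  coefficients alternate, so \<open>2 * j + 1\<close> scans lead to the coefficient of pair
  \<open>j\<close>. Garbage from other words is caught by encoding again.\<close>

definition coeff_fun :: "nat \<Rightarrow> nat \<Rightarrow> (nat \<Rightarrow> nat) \<Rightarrow> nat" where
  "coeff_fun v j e = scan_num ((scan_rest ^^ (2 * j + 1)) (e v div 6))"

definition parse :: "nat \<Rightarrow> nat list \<Rightarrow> (nat \<times> ((nat \<Rightarrow> nat) \<Rightarrow> nat)) list" where
  "parse v ps = zip ps (map (coeff_fun v) [0..<length ps])"

lemma linspace_parse: "\<forall>(p, f)\<in>set (parse v ps). linspace f"
proof -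
  have "linspace (\<lambda>e. (scan_rest ^^ i) (e v div 6))" for i
    by (induction i) (auto intro: linspace_intros)
  then have "linspace (coeff_fun v j)" for j
    unfolding coeff_fun_def[abs_def] by (intro linspace_intros)
  then show ?thesis by (auto simp: parse_def dest!: set_zip_rightD)
qed

lemma scan_ocode:
  "map (\<lambda>j. scan_num ((scan_rest ^^ (2 * j + 1)) (wnum (ocode pcs)))) [0..<length pcs] = map snd pcs"
proof (induction pcs)
  case (Cons pc pcs)
  obtain p c where pc: "pc = (p, c)" by fastforce
  obtain z w where zw: "(if pcs = [] then [RPar] else Semi # ocode pcs) = z # w" "z = Semi \<or> z = RPar"
    "pcs \<noteq> [] \<Longrightarrow> w = ocode pcs" by (cases "pcs = []") auto
  let ?x = "wnum (ocode (pc # pcs))"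
  have 1: "scan_rest ?x = wnum (code_nat c @ z # w)"
    using scan_correct(2)[of Semi p "code_nat c @ z # w"] zw(1) by (simp add: pc)
  have 2: "scan_num (scan_rest ?x) = c" "scan_rest (scan_rest ?x) = wnum w"
    unfolding 1 using scan_correct[OF zw(2)] by auto
  have "map (\<lambda>j. scan_num ((scan_rest ^^ (2 * j + 1)) (wnum w))) [0..<length pcs] = map snd pcs"
    using Cons zw(3) by (cases "pcs = []") auto
  moreover have "(scan_rest ^^ (2 * Suc j + 1)) ?x = (scan_rest ^^ (2 * j + 1)) (wnum w)" for j
    unfolding 2(2)[symmetric] by (simp add: funpow_swap1)
  moreover have "[0..<length (pc # pcs)] = 0 # map Suc [0..<length pcs]"
    by (simp add: upt_conv_Cons map_Suc_upt del: upt_Suc)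
  ultimately show ?case
    using 2(1) by (simp only: list.map map_map o_def) (simp add: pc)
qed simp

lemma ev_parse:
  assumes "e v = wnum (LPar # ocode pcs)"
  shows "ev (parse v (map fst pcs)) e = pcs"
proof -
  have "e v div 6 = wnum (ocode pcs)" using assms by simp
  then have "map (\<lambda>j. coeff_fun v j e) [0..<length pcs] = map snd pcs"
    using scan_ocode[of pcs] by (simp add: coeff_fun_def)
  moreover have "ev (zip ps (map f js)) e = zip ps (map (\<lambda>j. f j e) js)" for ps js and f :: "nat \<Rightarrow> _"
    by (auto simp: ev_def intro!: nth_equalityI)
  ultimately show ?thesis by (simp add: parse_def zip_map_fst_snd)
qed

text \<open>Only the coefficients need a test; the condition on neighbouring exponents is
  constant.\<close>

lemma linspace_pred_normal:
  assumes "\<forall>(p, f)\<in>set pfs. linspace f"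
  shows "linspace_pred (\<lambda>e. normal (ev pfs e))"
proof -
  have "linspace_pred (\<lambda>e. \<forall>(p, c)\<in>set (ev pfs e). c \<ge> 1)"
    using assms
  proof (induction pfs)
    case Nil
    then show ?case by (simp add: linspace_pred_def linspace_const)
  next
    case (Cons pf pfs)
    then show ?case by (cases pf) (auto intro!: linspace_intros simp del: One_nat_def)
  qed
  moreover have "successively (\<lambda>(p, _) (q, _). p \<noteq> q) (ev pfs e) \<longleftrightarrow>
      successively (\<lambda>(p, _) (q, _). p \<noteq> q) pfs" for e
    by (simp add: ev_def successively_map split_def)
  moreover have "linspace_pred (\<lambda>e. b)" for b
    by (simp add: linspace_pred_def linspace_const)
  ultimately show ?thesis unfolding normal_def by (simp only:) (intro linspace_intros)
qed

text \<open>Induction on the finite set adds one test per shape; inputs failing all tests reach the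
  default \<open>wnum [Bot]\<close> of the empty set.\<close>

lemma linspace_by_shape:
  assumes "finite S" "\<And>ps. ps \<in> S \<Longrightarrow> linspace (\<lambda>e. H e (ev (parse v ps) e))"
  shows "\<exists>F. linspace F \<and>
    (\<forall>e pcs. normal pcs \<longrightarrow> map fst pcs \<in> S \<longrightarrow> e v = wnum (LPar # ocode pcs) \<longrightarrow> F e = H e pcs) \<and>
    (\<forall>e. (\<forall>pcs. normal pcs \<longrightarrow> map fst pcs \<in> S \<longrightarrow> e v \<noteq> wnum (LPar # ocode pcs)) \<longrightarrow> F e = wnum [Bot])"
  using assms
proof (induction S rule: finite_induct)
  case empty
  show ?case by (intro exI[of _ "\<lambda>e. wnum [Bot]"]) (auto intro: linspace_const)
next
  case (insert ps S)
  then obtain F where F: "linspace F"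
    "\<And>e pcs. normal pcs \<Longrightarrow> map fst pcs \<in> S \<Longrightarrow> e v = wnum (LPar # ocode pcs) \<Longrightarrow> F e = H e pcs"
    "\<And>e. (\<And>pcs. normal pcs \<Longrightarrow> map fst pcs \<in> S \<Longrightarrow> e v \<noteq> wnum (LPar # ocode pcs)) \<Longrightarrow> F e = wnum [Bot]"
    by (metis (no_types, lifting) insertCI)
  let ?pcs = "\<lambda>e. ev (parse v ps) e"
  \<comment> \<open>\<open>3 + 6 * wnum _\<close> puts the opening parenthesis back. Encoding again
    is not enough by itself: a word with a zero coefficient would pass although it codes
    nothing.\<close>
  let ?Q = "\<lambda>e. e v = 3 + 6 * wnum (ocode (?pcs e)) \<and> normal (?pcs e)"
  define F' where "F' e = (if ?Q e then H e (?pcs e) else F e)" for e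
  have "linspace_pred ?Q"
    by (intro linspace_pred_conj linspace_pred_eq linspace_intros linspace_ocode[OF linspace_parse]
        linspace_pred_normal[OF linspace_parse])
  then have "linspace F'"
    unfolding F'_def using F(1) insert.prems by (intro linspace_if) auto
  moreover have "F' e = H e pcs"
    if pcs: "normal pcs" "map fst pcs \<in> insert ps S" "e v = wnum (LPar # ocode pcs)" for e pcs
  proof (cases "?Q e")
    case True
    \<comment> \<open>A successful test determines the list, whichever shape \<open>pcs\<close> was
      taken from.\<close>
    then have "ocode (?pcs e) = ocode pcs" using pcs(3) by (simp add: wnum_inject)
    then have "?pcs e = pcs" by (rule ocode_inject)
    then show ?thesis using True by (simp add: F'_def)
  next
    case False
    have "map fst pcs \<noteq> ps"
    proof
      assume "map fst pcs = ps"
      then have "?pcs e = pcs" using ev_parse[of e v pcs, OF pcs(3)] by simp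
      with False pcs show False by simp
    qed
    then have "F e = H e pcs" using F(2)[of pcs e] pcs by simp
    moreover have "F' e = F e" unfolding F'_def using False by (rule if_not_P)
    ultimately show ?thesis by simp
  qed
  moreover have "F' e = wnum [Bot]"
    if no: "\<And>pcs. normal pcs \<Longrightarrow> map fst pcs \<in> insert ps S \<Longrightarrow> e v \<noteq> wnum (LPar # ocode pcs)" for e
  proof -
    have "map fst (?pcs e) = ps"
      by (auto simp: ev_def parse_def split_def intro!: nth_equalityI)
    then have "\<not> ?Q e" using no[of "?pcs e"] by auto
    then have "F' e = F e" unfolding F'_def by (rule if_not_P)
    then show ?thesis using F(3)[of e] no by simp
  qed
  ultimately show ?case by blast
qed

lemma linspace_by_Psi:
  assumes "1 \<le> k"
    and "\<And>pfs. \<forall>(p, f)\<in>set pfs. linspace f \<Longrightarrow> linspace (\<lambda>e. H e (osum (ev pfs e)))"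
  shows "\<exists>F. linspace F \<and>
    (\<forall>e. \<forall>\<alpha>\<in>Psi k m. e v = wnum (code_ord \<alpha>) \<longrightarrow> F e = H e \<alpha>) \<and>
    (\<forall>e. (\<forall>\<alpha>\<in>Psi k m. e v \<noteq> wnum (code_ord \<alpha>)) \<longrightarrow> F e = wnum [Bot])"
proof -
  obtain F where F: "linspace F"
    "\<forall>e pcs. normal pcs \<longrightarrow> map fst pcs \<in> shapes k m \<longrightarrow> e v = wnum (LPar # ocode pcs) \<longrightarrow>
      F e = H e (osum pcs)"
    "\<forall>e. (\<forall>pcs. normal pcs \<longrightarrow> map fst pcs \<in> shapes k m \<longrightarrow> e v \<noteq> wnum (LPar # ocode pcs)) \<longrightarrow>
      F e = wnum [Bot]"
    using linspace_by_shape[OF finite_shapes, of k m "\<lambda>e pcs. H e (osum pcs)" v] assms(2) linspace_parse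
    by blast
  show ?thesis
  proof (intro exI[of _ F] conjI F(1) allI ballI impI)
    fix e \<alpha> assume "\<alpha> \<in> Psi k m" "e v = wnum (code_ord \<alpha>)"
    then show "F e = H e \<alpha>" using F(2) unfolding Psi_iff[OF assms(1)] by (auto simp: code_ord_osum)
  next
    fix e assume "\<forall>\<alpha>\<in>Psi k m. e v \<noteq> wnum (code_ord \<alpha>)"
    then have "\<forall>pcs. normal pcs \<longrightarrow> map fst pcs \<in> shapes k m \<longrightarrow> e v \<noteq> wnum (LPar # ocode pcs)"
      using Psi_iff[OF assms(1)] code_ord_osum by metis
    then show "F e = wnum [Bot]" using F(3) by blast
  qed
qed

lemma code_ord_inject:
  assumes "1 \<le> k" "\<alpha> \<in> Psi k m" "\<beta> \<in> Psi k m" "code_ord \<alpha> = code_ord \<beta>"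
  shows "\<alpha> = \<beta>"
  using assms(2-4) unfolding Psi_iff[OF assms(1)] by (auto simp: code_ord_osum dest!: ocode_inject)

lemma coded_enc: "inj_on enc A \<Longrightarrow> x \<in> A \<Longrightarrow> coded enc out A F (enc x) = out (F x)"
  by (simp add: coded_def)

lemma coded_Psi_nat_in_E2:
  assumes "1 \<le> k"
    and "\<And>pfs n. \<forall>(p, f)\<in>set pfs. linspace f \<Longrightarrow> linspace n \<Longrightarrow> linspace (\<lambda>e. H (osum (ev pfs e)) (n e))"
  shows "coded (\<lambda>(\<alpha>, n). [code_ord \<alpha>, code_nat n]) code_nat (Psi k m \<times> UNIV) (\<lambda>(\<alpha>, n). H \<alpha> n) \<in> E2 2"
proof -
  let ?enc = "\<lambda>(\<alpha>, n). [code_ord \<alpha>, code_nat n]"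
  let ?n = "\<lambda>e. num_of_code (e 1)"
  have inj: "inj_on ?enc (Psi k m \<times> UNIV)"
    using code_ord_inject[OF assms(1)] by (auto simp: inj_on_def code_nat_inject)
  have "\<exists>F. linspace F \<and>
      (\<forall>e. \<forall>\<alpha>\<in>Psi k m. e 0 = wnum (code_ord \<alpha>) \<longrightarrow> F e = prep (H \<alpha> (?n e)) 0) \<and>
      (\<forall>e. (\<forall>\<alpha>\<in>Psi k m. e 0 \<noteq> wnum (code_ord \<alpha>)) \<longrightarrow> F e = wnum [Bot])"
    by (rule linspace_by_Psi[OF assms(1)]) (intro linspace_intros assms(2); blast)
  then obtain F where F: "linspace F"
    "\<forall>e. \<forall>\<alpha>\<in>Psi k m. e 0 = wnum (code_ord \<alpha>) \<longrightarrow> F e = prep (H \<alpha> (?n e)) 0"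
    "\<forall>e. (\<forall>\<alpha>\<in>Psi k m. e 0 \<noteq> wnum (code_ord \<alpha>)) \<longrightarrow> F e = wnum [Bot]"
    by (elim exE conjE)
  \<comment> \<open>The numeral is validated like the ordinal, by decoding and encoding it
    again.\<close>
  define f where "f e = (if prep (?n e) 0 = e 1 then F e else wnum [Bot])" for e
  show ?thesis
  proof (rule linspace_E2[where f = f])
    show "linspace f" unfolding f_def by (intro linspace_intros F(1))
  next
    fix ws :: "sigma list list" and e
    assume "length ws = 2" and e: "\<And>i. i < 2 \<Longrightarrow> e i = wnum (ws ! i)"
    then obtain u v where ws: "ws = [u, v]" by (auto simp: numeral_2_eq_2 length_Suc_conv)
    have uv: "e 0 = wnum u" "e 1 = wnum v" using e[of 0] e[of 1] by (auto simp: ws)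
    show "f e = wnum (coded ?enc code_nat (Psi k m \<times> UNIV) (\<lambda>(\<alpha>, n). H \<alpha> n) ws)"
    proof (cases "ws \<in> ?enc ` (Psi k m \<times> UNIV)")
      case True
      then obtain \<alpha> n where \<alpha>: "\<alpha> \<in> Psi k m" "ws = ?enc (\<alpha>, n)" by auto
      then have "u = code_ord \<alpha>" "v = code_nat n" by (auto simp: ws)
      then show ?thesis
        using bspec[OF spec[OF F(2), of e] \<alpha>(1)] coded_enc[OF inj, of "(\<alpha>, n)" code_nat "\<lambda>(\<alpha>, n). H \<alpha> n"] \<alpha> uv by (simp add: f_def num_of_code prep_Nil)
    next
      case False
      have "F e = wnum [Bot]" if "prep (?n e) 0 = e 1"
      proof (rule mp[OF spec[OF F(3)]])
        have "v = code_nat (?n e)" using that uv by (simp add: prep_Nil wnum_inject)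
        then show "\<forall>\<alpha>\<in>Psi k m. e 0 \<noteq> wnum (code_ord \<alpha>)"
          using False uv by (auto simp: ws wnum_inject image_iff)
      qed
      with False show ?thesis by (auto simp: f_def coded_def)
    qed
  qed simp
qed

lemma coded_R_in_E2:
  assumes "1 \<le> k"
  shows "coded_R (Psi k m) \<in> E2 3"
proof -
  let ?enc = "\<lambda>(i, \<alpha>, n). [code_nat i, code_ord \<alpha>, code_nat n]"
  let ?A = "UNIV \<times> Psi k m \<times> UNIV"
  let ?i = "\<lambda>e. num_of_code (e 0)" and ?n = "\<lambda>e. num_of_code (e 2)"
  have inj: "inj_on ?enc ?A"
    using code_ord_inject[OF assms(1)] by (auto simp: inj_on_def code_nat_inject)
  have R: "linspace (\<lambda>e. wnum (code_ord (R_hier (?i e) (osum (ev pfs e)) (?n e))))"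
    if "\<forall>(p, f)\<in>set pfs. linspace f" for pfs
    using that linspace_code_rlist[of "[]" pfs ?n ?i] by (simp add: R_hier_osum linspace_intros)
  have "\<exists>F. linspace F \<and>
      (\<forall>e. \<forall>\<alpha>\<in>Psi k m. e 1 = wnum (code_ord \<alpha>) \<longrightarrow> F e = wnum (code_ord (R_hier (?i e) \<alpha> (?n e)))) \<and>
      (\<forall>e. (\<forall>\<alpha>\<in>Psi k m. e 1 \<noteq> wnum (code_ord \<alpha>)) \<longrightarrow> F e = wnum [Bot])"
    by (rule linspace_by_Psi[OF assms(1)]) (rule R)
  then obtain F where F: "linspace F"
    "\<forall>e. \<forall>\<alpha>\<in>Psi k m. e 1 = wnum (code_ord \<alpha>) \<longrightarrow> F e = wnum (code_ord (R_hier (?i e) \<alpha> (?n e)))"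
    "\<forall>e. (\<forall>\<alpha>\<in>Psi k m. e 1 \<noteq> wnum (code_ord \<alpha>)) \<longrightarrow> F e = wnum [Bot]"
    by (elim exE conjE)
  define f where "f e = (if prep (?i e) 0 = e 0 \<and> prep (?n e) 0 = e 2 then F e else wnum [Bot])" for e
  show ?thesis
  proof (rule linspace_E2[where f = f])
    show "linspace f" unfolding f_def by (intro linspace_intros F(1))
  next
    fix ws :: "sigma list list" and e
    assume "length ws = 3" and e: "\<And>i. i < 3 \<Longrightarrow> e i = wnum (ws ! i)"
    then obtain t u v where ws: "ws = [t, u, v]" by (auto simp: numeral_3_eq_3 length_Suc_conv)
    have uv: "e 0 = wnum t" "e 1 = wnum u" "e 2 = wnum v" using e[of 0] e[of 1] e[of 2] by (auto simp: ws)
    show "f e = wnum (coded_R (Psi k m) ws)"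
    proof (cases "ws \<in> ?enc ` ?A")
      case True
      then obtain i \<alpha> n where \<alpha>: "\<alpha> \<in> Psi k m" "ws = ?enc (i, \<alpha>, n)" by auto
      then have "t = code_nat i" "u = code_ord \<alpha>" "v = code_nat n" by (auto simp: ws)
      then show ?thesis
        using bspec[OF spec[OF F(2), of e] \<alpha>(1)] coded_enc[OF inj, of "(i, \<alpha>, n)" code_ord "\<lambda>(i, \<alpha>, n). R_hier i \<alpha> n"] \<alpha> uv
        by (simp add: f_def num_of_code prep_Nil coded_R_def)
    next
      case False
      have "F e = wnum [Bot]" if "prep (?i e) 0 = e 0 \<and> prep (?n e) 0 = e 2"
      proof (rule mp[OF spec[OF F(3)]])
        have "t = code_nat (?i e)" "v = code_nat (?n e)" using that uv by (auto simp: prep_Nil wnum_inject)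
        then show "\<forall>\<alpha>\<in>Psi k m. e 1 \<noteq> wnum (code_ord \<alpha>)"
          using False uv by (auto simp: ws wnum_inject image_iff)
      qed
      with False show ?thesis by (auto simp: f_def coded_def coded_R_def)
    qed
  qed simp
qed

theorem theorem9p19:
  fixes k m :: nat
  assumes "k \<ge> 1" and "m \<ge> 1"
  shows "coded_R (Psi k m) \<in> E2 3 \<and> coded_L (Psi k m) \<in> E2 2 \<and> coded_G (Psi k m) \<in> E2 2"
  unfolding coded_L_def coded_G_def
  by (intro conjI coded_R_in_E2 coded_Psi_nat_in_E2 linspace_L_hier linspace_G_hier assms(1)) auto

end
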